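(* Let $\lambda\in\Bbbk$, $\lambda\ne0$. Every tri-$\mathrm{Var}$-dendriform algebra $A$ over $\Bbbk$ embeds into its universal enveloping Rota--Baxter $\mathrm{Var}$-algebra of weight $\lambda$; that is, the canonical map from $A$ to this universal enveloping algebra is injective.
   Context: $\Bbbk$ is an arbitrary field. $\Omega=\{\circ_i\mid i\in I\}$ is a set of binary operation symbols; an $\Omega$-algebra is a $\Bbbk$-linear space with bilinear operations $\circ_i$, $i\in I$. An $\Omega^{(3)}$-algebra is a $\Bbbk$-linear space with bilinear operations $\vdash_i,\dashv_i,\perp_i$, $i\in I$. $\mathrm{Var}$ is the variety of $\Omega$-algebras defined by a family $S$ of poly-linear identities of degrees greater than one: each $f\in S$ of degree $n$ is a $\Bbbk$-linear combination of non-associative $\Omega$-monomials in which each of $x_1,\dots,x_n$ occurs exactly once (in any order and with any bracketing). For a poly-linear $\Omega$-monomial $v$, let $v^*$ be the $\Omega^{(3)}$-polynomial obtained by replacing each $\circ_j$ in $v$ with $\vdash_j+\dashv_j+\perp_j$ (and expanding). For a poly-linear $\Omega$-monomial $u$ and a nonempty set $H$ of indices of variables occurring in $u$, define $\Phi^*(u^H)$ recursively: if $u$ is a single variable, $\Phi^*(u^H)=u$; if $u=v\circ_i w$, let $H_1$ (resp. $H_2$) be the set of $k\in H$ such that $x_k$ occurs in $v$ (resp. $w$), and put $$\Phi^*(u^H)=\begin{cases}\Phi^*(v^{H_1})\perp_i\Phi^*(w^{H_2}), & H_1,H_2\neq\emptyset,\\ v^*\vdash_i\Phi^*(w^{H}),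 & H_1=\emptyset,\\ \Phi^*(v^{H})\dashv_i w^*, & H_2=\emptyset.\end{cases}$$ Extend linearly to poly-linear $f$. A tri-$\mathrm{Var}$-dendriform algebra is an $\Omega^{(3)}$-algebra satisfying the identities $\Phi^*(f^H)=0$ for all $f\in S$ and all nonempty $H\subseteq\{1,\dots,\deg f\}$. A Rota--Baxter $\mathrm{Var}$-algebra of weight $\lambda$ is an algebra $B\in\mathrm{Var}$ with a linear map $R:B\to B$ such that $R(x)\circ_i R(y)=R(x\circ_i R(y)+R(x)\circ_i y+\lambda\,x\circ_i y)$ for all $x,y\in B$, $i\in I$. Each such $(B,R)$ is regarded as an $\Omega^{(3)}$-algebra $B^{\mathrm{dend}}$ (which is tri-$\mathrm{Var}$-dendriform) via $x\vdash_i y=R(x)\circ_i y$, $x\dashv_i y=x\circ_i R(y)$, $x\perp_i y=\lambda\,x\circ_i y$. The universal enveloping Rota--Baxter $\mathrm{Var}$-algebra of weight $\lambda$ of $A$ is a Rota--Baxter $\mathrm{Var}$-algebra $U$ of weight $\lambda$ with a homomorphism of $\Omega^{(3)}$-algebras $A\to U^{\mathrm{dend}}$ (the canonical map) such that every homomorphism of $\Omega^{(3)}$-algebras $A\to B^{\mathrm{dend}}$, for $B$ a Rota--Baxter $\mathrm{Var}$-algebra of weight $\lambda$, factors uniquely through it via a homomorphism $U\to B$ of Rota--Baxter algebras (an $\Omega$-algebra homomorphism commuting with the Rota--Baxter operators). *)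

theory Defs
  imports "HOL-Algebra.Module"
begin

section \<open>Algebras with a family of bilinear operations\<close>

text \<open>The record \<open>module\<close> of HOL-Algebra also carries the fields \<open>mult\<close> and \<open>one\<close>; they play no
  role here, and no axiom mentions them.\<close>

record ('k, 'm, 'i) omega_alg = "('k, 'm) module" +
  aop :: "'i \<Rightarrow> 'm \<Rightarrow> 'm \<Rightarrow> 'm"

locale omega_algebra = module K M + field K
  for K :: "('k, 'c) ring_scheme" (structure)
  and M :: "('k, 'm, 'i, 'd) omega_alg_scheme" (structure) +
  assumes aop_closed:
      "\<lbrakk> x \<in> carrier M; y \<in> carrier M \<rbrakk> \<Longrightarrow> aop M i x y \<in> carrier M"
    and aop_add_left:
      "\<lbrakk> x \<in> carrier M; y \<in> carrier M; z \<in> carrier M \<rbrakk>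
        \<Longrightarrow> aop M i (x \<oplus>\<^bsub>M\<^esub> y) z = aop M i x z \<oplus>\<^bsub>M\<^esub> aop M i y z"
    and aop_add_right:
      "\<lbrakk> x \<in> carrier M; y \<in> carrier M; z \<in> carrier M \<rbrakk>
        \<Longrightarrow> aop M i x (y \<oplus>\<^bsub>M\<^esub> z) = aop M i x y \<oplus>\<^bsub>M\<^esub> aop M i x z"
    and aop_smult_left:
      "\<lbrakk> c \<in> carrier K; x \<in> carrier M; y \<in> carrier M \<rbrakk>
        \<Longrightarrow> aop M i (c \<odot>\<^bsub>M\<^esub> x) y = c \<odot>\<^bsub>M\<^esub> aop M i x y"
    and aop_smult_right:
      "\<lbrakk> c \<in> carrier K; x \<in> carrier M; y \<in> carrier M \<rbrakk>
        \<Longrightarrow> aop M i x (c \<odot>\<^bsub>M\<^esub> y) = c \<odot>\<^bsub>M\<^esub> aop M i x y"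

definition linear_maps ::
  "('k, 'c) ring_scheme \<Rightarrow> ('k, 'm, 'd) module_scheme \<Rightarrow> ('k, 'n, 'e) module_scheme \<Rightarrow> ('m \<Rightarrow> 'n) set"
  where "linear_maps K M N = {h \<in> carrier M \<rightarrow> carrier N.
    (\<forall>x\<in>carrier M. \<forall>y\<in>carrier M. h (x \<oplus>\<^bsub>M\<^esub> y) = h x \<oplus>\<^bsub>N\<^esub> h y) \<and>
    (\<forall>c\<in>carrier K. \<forall>x\<in>carrier M. h (c \<odot>\<^bsub>M\<^esub> x) = c \<odot>\<^bsub>N\<^esub> h x)}"

definition omega_homs ::
  "('k, 'c) ring_scheme \<Rightarrow> ('k, 'm, 'i, 'd) omega_alg_scheme
    \<Rightarrow> ('k, 'n, 'i, 'e) omega_alg_scheme \<Rightarrow> ('m \<Rightarrow> 'n) set"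
  where "omega_homs K M N = {h \<in> linear_maps K M N.
    \<forall>i. \<forall>x\<in>carrier M. \<forall>y\<in>carrier M. h (aop M i x y) = aop N i (h x) (h y)}"


section \<open>Non-associative polynomials and identities\<close>

datatype 'i mono = MVar nat | MOp 'i "'i mono" "'i mono"

fun leaves :: "'i mono \<Rightarrow> nat list" where
  "leaves (MVar k) = [k]"
| "leaves (MOp i v w) = leaves v @ leaves w"

text \<open>A polynomial is the function that assigns to each monomial its coefficient.\<close>

type_synonym ('k, 'i) npoly = "'i mono \<Rightarrow> 'k"

definition supp :: "('k, 'c) ring_scheme \<Rightarrow> ('k, 'i) npoly \<Rightarrow> 'i mono set" where
  "supp K f = {u. f u \<noteq> \<zero>\<^bsub>K\<^esub>}"

definition polylinear :: "('k, 'c) ring_scheme \<Rightarrow> nat \<Rightarrow> ('k, 'i) npoly \<Rightarrow> bool" where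
  "polylinear K n f \<longleftrightarrow> range f \<subseteq> carrier K \<and> finite (supp K f) \<and>
    (\<forall>u\<in>supp K f. distinct (leaves u) \<and> set (leaves u) = {1..n})"

fun eval_mono :: "('k, 'm, 'i, 'd) omega_alg_scheme \<Rightarrow> (nat \<Rightarrow> 'm) \<Rightarrow> 'i mono \<Rightarrow> 'm" where
  "eval_mono M \<sigma> (MVar k) = \<sigma> k"
| "eval_mono M \<sigma> (MOp i v w) = aop M i (eval_mono M \<sigma> v) (eval_mono M \<sigma> w)"

definition eval_poly :: "('k, 'c) ring_scheme \<Rightarrow> ('k, 'm, 'i, 'd) omega_alg_scheme
    \<Rightarrow> (nat \<Rightarrow> 'm) \<Rightarrow> ('k, 'i) npoly \<Rightarrow> 'm" where
  "eval_poly K M \<sigma> f = (\<Oplus>\<^bsub>M\<^esub>u\<in>supp K f. f u \<odot>\<^bsub>M\<^esub> eval_mono M \<sigma> u)"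

definition satisfies :: "('k, 'c) ring_scheme \<Rightarrow> ('k, 'm, 'i, 'd) omega_alg_scheme
    \<Rightarrow> ('k, 'i) npoly \<Rightarrow> bool" where
  "satisfies K M f \<longleftrightarrow> (\<forall>\<sigma>. range \<sigma> \<subseteq> carrier M \<longrightarrow> eval_poly K M \<sigma> f = \<zero>\<^bsub>M\<^esub>)"

definition var_algebra :: "('k, 'c) ring_scheme \<Rightarrow> ('k, 'i) npoly set
    \<Rightarrow> ('k, 'm, 'i, 'd) omega_alg_scheme \<Rightarrow> bool" where
  "var_algebra K S M \<longleftrightarrow> omega_algebra K M \<and> (\<forall>f\<in>S. satisfies K M f)"


section \<open>Tri-dendriform algebras\<close>

text \<open>An operation symbol of \<open>\<Omega>\<^sup>(\<^sup>3\<^sup>)\<close> is a pair \<open>(i, t)\<close>: \<open>(i, Vdash)\<close>, \<open>(i, Dashv)\<close> and \<open>(i, Perp)\<close>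
  stand for \<open>\<turnstile>\<^sub>i\<close>, \<open>\<stileturn>\<^sub>i\<close> and \<open>\<bottom>\<^sub>i\<close>.\<close>

datatype tri = Vdash | Dashv | Perp

definition var_poly :: "('k, 'c) ring_scheme \<Rightarrow> nat \<Rightarrow> ('k, 'j) npoly" where
  "var_poly K k = (\<lambda>m. if m = MVar k then \<one>\<^bsub>K\<^esub> else \<zero>\<^bsub>K\<^esub>)"

definition op_poly :: "('k, 'c) ring_scheme \<Rightarrow> 'j \<Rightarrow> ('k, 'j) npoly \<Rightarrow> ('k, 'j) npoly \<Rightarrow> ('k, 'j) npoly"
  where "op_poly K j f g = (\<lambda>m. case m of MVar k \<Rightarrow> \<zero>\<^bsub>K\<^esub>
    | MOp j' v w \<Rightarrow> if j' = j then f v \<otimes>\<^bsub>K\<^esub> g w else \<zero>\<^bsub>K\<^esub>)"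

primrec star :: "('k, 'c) ring_scheme \<Rightarrow> 'i mono \<Rightarrow> ('k, 'i \<times> tri) npoly" where
  "star K (MVar k) = var_poly K k"
| "star K (MOp i v w) = (\<lambda>m.
      op_poly K (i, Vdash) (star K v) (star K w) m
      \<oplus>\<^bsub>K\<^esub> op_poly K (i, Dashv) (star K v) (star K w) m
      \<oplus>\<^bsub>K\<^esub> op_poly K (i, Perp) (star K v) (star K w) m)"

text \<open>Only nonempty sets \<open>H\<close> of variables of the monomial are relevant, so that in the clause for
  \<open>MOp\<close> the two intersections are never both empty.\<close>

primrec Phi_mono :: "('k, 'c) ring_scheme \<Rightarrow> 'i mono \<Rightarrow> nat set \<Rightarrow> ('k, 'i \<times> tri) npoly" where
  "Phi_mono K (MVar k) H = var_poly K k"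
| "Phi_mono K (MOp i v w) H =
    (let H1 = H \<inter> set (leaves v); H2 = H \<inter> set (leaves w) in
      if H1 \<noteq> {} \<and> H2 \<noteq> {} then op_poly K (i, Perp) (Phi_mono K v H1) (Phi_mono K w H2)
      else if H1 = {} then op_poly K (i, Vdash) (star K v) (Phi_mono K w H)
      else op_poly K (i, Dashv) (Phi_mono K v H) (star K w))"

definition Phi :: "('k, 'c) ring_scheme \<Rightarrow> ('k, 'i) npoly \<Rightarrow> nat set \<Rightarrow> ('k, 'i \<times> tri) npoly" where
  "Phi K f H = (\<lambda>m. \<Oplus>\<^bsub>K\<^esub>u\<in>supp K f. f u \<otimes>\<^bsub>K\<^esub> Phi_mono K u H m)"

text \<open>Quantifying over \<open>n\<close> amounts to \<open>n = deg f\<close>: the degree of a polylinear \<open>f\<close> is determined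
  by \<open>f\<close> unless \<open>f = 0\<close>, and then \<open>Phi K f H = 0\<close>.\<close>

definition tri_dendriform :: "('k, 'c) ring_scheme \<Rightarrow> ('k, 'i) npoly set
    \<Rightarrow> ('k, 'a, 'i \<times> tri, 'd) omega_alg_scheme \<Rightarrow> bool" where
  "tri_dendriform K S A \<longleftrightarrow> omega_algebra K A \<and>
    (\<forall>f\<in>S. \<forall>n H. polylinear K n f \<and> H \<noteq> {} \<and> H \<subseteq> {1..n} \<longrightarrow> satisfies K A (Phi K f H))"


section \<open>Rota--Baxter algebras\<close>

record ('k, 'm, 'i) rb_alg = "('k, 'm, 'i) omega_alg" +
  rbop :: "'m \<Rightarrow> 'm"

definition rb_var_algebra :: "('k, 'c) ring_scheme \<Rightarrow> 'k \<Rightarrow> ('k, 'i) npoly set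
    \<Rightarrow> ('k, 'm, 'i) rb_alg \<Rightarrow> bool" where
  "rb_var_algebra K lam S B \<longleftrightarrow> var_algebra K S B \<and> rbop B \<in> linear_maps K B B \<and>
    (\<forall>i. \<forall>x\<in>carrier B. \<forall>y\<in>carrier B.
      aop B i (rbop B x) (rbop B y) =
      rbop B (aop B i x (rbop B y) \<oplus>\<^bsub>B\<^esub> aop B i (rbop B x) y \<oplus>\<^bsub>B\<^esub> lam \<odot>\<^bsub>B\<^esub> aop B i x y))"

definition rb_homs :: "('k, 'c) ring_scheme \<Rightarrow> ('k, 'm, 'i) rb_alg \<Rightarrow> ('k, 'n, 'i) rb_alg
    \<Rightarrow> ('m \<Rightarrow> 'n) set" where
  "rb_homs K B C = {h \<in> omega_homs K B C. \<forall>x\<in>carrier B. h (rbop B x) = rbop C (h x)}"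

definition dend :: "'k \<Rightarrow> ('k, 'm, 'i) rb_alg \<Rightarrow> ('k, 'm, 'i \<times> tri) omega_alg" where
  "dend lam B = \<lparr>carrier = carrier B, mult = mult B, one = one B, zero = zero B, add = add B,
    smult = smult B,
    aop = (\<lambda>(i, t) x y. case t of
        Vdash \<Rightarrow> aop B i (rbop B x) y
      | Dashv \<Rightarrow> aop B i x (rbop B y)
      | Perp \<Rightarrow> lam \<odot>\<^bsub>B\<^esub> aop B i x y)\<rparr>"


section \<open>Universal enveloping Rota--Baxter algebras\<close>

text \<open>A formula cannot quantify over types. Hence the type \<open>'b\<close> of the elements of the test
  algebras \<open>B\<close> is an explicit parameter; the full universal property is the one for every \<open>'b\<close>.\<close>

definition universal_rb_envelope :: "'b itself \<Rightarrow> ('k, 'c) ring_scheme \<Rightarrow> 'k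
    \<Rightarrow> ('k, 'i) npoly set \<Rightarrow> ('k, 'a, 'i \<times> tri) omega_alg
    \<Rightarrow> ('k, 'u, 'i) rb_alg \<Rightarrow> ('a \<Rightarrow> 'u) \<Rightarrow> bool" where
  "universal_rb_envelope (_ :: 'b itself) K lam S A U \<iota> \<longleftrightarrow>
    rb_var_algebra K lam S U \<and> \<iota> \<in> omega_homs K A (dend lam U) \<and>
    (\<forall>(B :: ('k, 'b, 'i) rb_alg) h.
      rb_var_algebra K lam S B \<and> h \<in> omega_homs K A (dend lam B) \<longrightarrow>
      (\<exists>\<phi>\<in>rb_homs K U B. (\<forall>a\<in>carrier A. \<phi> (\<iota> a) = h a) \<and>
        (\<forall>\<psi>\<in>rb_homs K U B. (\<forall>a\<in>carrier A. \<psi> (\<iota> a) = h a) \<longrightarrow>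
          (\<forall>x\<in>carrier U. \<psi> x = \<phi> x))))"

text \<open>A model by generators and relations, independent of \<open>'b\<close>: terms over \<open>A\<close> modulo the least
  congruence that imposes the axioms of a Rota--Baxter algebra in the variety and makes
  the inclusion of generators a homomorphism from \<open>A\<close>.\<close>

datatype ('k, 'i, 'a) rb_term = Gen 'a
  | TZero
  | TAdd "('k, 'i, 'a) rb_term" "('k, 'i, 'a) rb_term"
  | TSmult 'k "('k, 'i, 'a) rb_term"
  | TOp 'i "('k, 'i, 'a) rb_term" "('k, 'i, 'a) rb_term"
  | TRB "('k, 'i, 'a) rb_term"

inductive_set rb_terms :: "('k, 'c) ring_scheme \<Rightarrow> ('k, 'a, 'i \<times> tri) omega_alg
    \<Rightarrow> ('k, 'i, 'a) rb_term set"
  for K :: "('k, 'c) ring_scheme" and A :: "('k, 'a, 'i \<times> tri) omega_alg" where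
  Gen: "a \<in> carrier A \<Longrightarrow> Gen a \<in> rb_terms K A"
| Zero: "TZero \<in> rb_terms K A"
| Add: "\<lbrakk> s \<in> rb_terms K A; t \<in> rb_terms K A \<rbrakk> \<Longrightarrow> TAdd s t \<in> rb_terms K A"
| Smult: "\<lbrakk> c \<in> carrier K; t \<in> rb_terms K A \<rbrakk> \<Longrightarrow> TSmult c t \<in> rb_terms K A"
| Op: "\<lbrakk> s \<in> rb_terms K A; t \<in> rb_terms K A \<rbrakk> \<Longrightarrow> TOp i s t \<in> rb_terms K A"
| RB: "t \<in> rb_terms K A \<Longrightarrow> TRB t \<in> rb_terms K A"

fun term_subst :: "(nat \<Rightarrow> ('k, 'i, 'a) rb_term) \<Rightarrow> 'i mono \<Rightarrow> ('k, 'i, 'a) rb_term" where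
  "term_subst \<sigma> (MVar k) = \<sigma> k"
| "term_subst \<sigma> (MOp i v w) = TOp i (term_subst \<sigma> v) (term_subst \<sigma> w)"

inductive_set rb_rel :: "('k, 'c) ring_scheme \<Rightarrow> 'k \<Rightarrow> ('k, 'i) npoly set
    \<Rightarrow> ('k, 'a, 'i \<times> tri) omega_alg \<Rightarrow> ('k, 'i, 'a) rb_term rel"
  for K :: "('k, 'c) ring_scheme" and lam :: 'k and S :: "('k, 'i) npoly set"
    and A :: "('k, 'a, 'i \<times> tri) omega_alg" where
  refl: "s \<in> rb_terms K A \<Longrightarrow> (s, s) \<in> rb_rel K lam S A"
| sym: "(s, t) \<in> rb_rel K lam S A \<Longrightarrow> (t, s) \<in> rb_rel K lam S A"
| trans: "\<lbrakk> (s, t) \<in> rb_rel K lam S A; (t, r) \<in> rb_rel K lam S A \<rbrakk> \<Longrightarrow> (s, r) \<in> rb_rel K lam S A"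
| cong_add: "\<lbrakk> (s, s') \<in> rb_rel K lam S A; (t, t') \<in> rb_rel K lam S A \<rbrakk>
    \<Longrightarrow> (TAdd s t, TAdd s' t') \<in> rb_rel K lam S A"
| cong_smult: "\<lbrakk> c \<in> carrier K; (s, s') \<in> rb_rel K lam S A \<rbrakk>
    \<Longrightarrow> (TSmult c s, TSmult c s') \<in> rb_rel K lam S A"
| cong_op: "\<lbrakk> (s, s') \<in> rb_rel K lam S A; (t, t') \<in> rb_rel K lam S A \<rbrakk>
    \<Longrightarrow> (TOp i s t, TOp i s' t') \<in> rb_rel K lam S A"
| cong_rb: "(s, s') \<in> rb_rel K lam S A \<Longrightarrow> (TRB s, TRB s') \<in> rb_rel K lam S A"
| add_assoc: "\<lbrakk> r \<in> rb_terms K A; s \<in> rb_terms K A; t \<in> rb_terms K A \<rbrakk>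
    \<Longrightarrow> (TAdd (TAdd r s) t, TAdd r (TAdd s t)) \<in> rb_rel K lam S A"
| add_comm: "\<lbrakk> s \<in> rb_terms K A; t \<in> rb_terms K A \<rbrakk>
    \<Longrightarrow> (TAdd s t, TAdd t s) \<in> rb_rel K lam S A"
| add_zero: "s \<in> rb_terms K A \<Longrightarrow> (TAdd TZero s, s) \<in> rb_rel K lam S A"
| add_neg: "s \<in> rb_terms K A \<Longrightarrow> (TAdd (TSmult (\<ominus>\<^bsub>K\<^esub> \<one>\<^bsub>K\<^esub>) s) s, TZero) \<in> rb_rel K lam S A"
| smult_add_left: "\<lbrakk> c \<in> carrier K; d \<in> carrier K; s \<in> rb_terms K A \<rbrakk>
    \<Longrightarrow> (TSmult (c \<oplus>\<^bsub>K\<^esub> d) s, TAdd (TSmult c s) (TSmult d s)) \<in> rb_rel K lam S A"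
| smult_add_right: "\<lbrakk> c \<in> carrier K; s \<in> rb_terms K A; t \<in> rb_terms K A \<rbrakk>
    \<Longrightarrow> (TSmult c (TAdd s t), TAdd (TSmult c s) (TSmult c t)) \<in> rb_rel K lam S A"
| smult_assoc: "\<lbrakk> c \<in> carrier K; d \<in> carrier K; s \<in> rb_terms K A \<rbrakk>
    \<Longrightarrow> (TSmult (c \<otimes>\<^bsub>K\<^esub> d) s, TSmult c (TSmult d s)) \<in> rb_rel K lam S A"
| smult_one: "s \<in> rb_terms K A \<Longrightarrow> (TSmult \<one>\<^bsub>K\<^esub> s, s) \<in> rb_rel K lam S A"
| op_add_left: "\<lbrakk> r \<in> rb_terms K A; s \<in> rb_terms K A; t \<in> rb_terms K A \<rbrakk>
    \<Longrightarrow> (TOp i (TAdd r s) t, TAdd (TOp i r t) (TOp i s t)) \<in> rb_rel K lam S A"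
| op_add_right: "\<lbrakk> r \<in> rb_terms K A; s \<in> rb_terms K A; t \<in> rb_terms K A \<rbrakk>
    \<Longrightarrow> (TOp i r (TAdd s t), TAdd (TOp i r s) (TOp i r t)) \<in> rb_rel K lam S A"
| op_smult_left: "\<lbrakk> c \<in> carrier K; s \<in> rb_terms K A; t \<in> rb_terms K A \<rbrakk>
    \<Longrightarrow> (TOp i (TSmult c s) t, TSmult c (TOp i s t)) \<in> rb_rel K lam S A"
| op_smult_right: "\<lbrakk> c \<in> carrier K; s \<in> rb_terms K A; t \<in> rb_terms K A \<rbrakk>
    \<Longrightarrow> (TOp i s (TSmult c t), TSmult c (TOp i s t)) \<in> rb_rel K lam S A"
| rb_add: "\<lbrakk> s \<in> rb_terms K A; t \<in> rb_terms K A \<rbrakk>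
    \<Longrightarrow> (TRB (TAdd s t), TAdd (TRB s) (TRB t)) \<in> rb_rel K lam S A"
| rb_smult: "\<lbrakk> c \<in> carrier K; s \<in> rb_terms K A \<rbrakk>
    \<Longrightarrow> (TRB (TSmult c s), TSmult c (TRB s)) \<in> rb_rel K lam S A"
| rota_baxter: "\<lbrakk> s \<in> rb_terms K A; t \<in> rb_terms K A \<rbrakk>
    \<Longrightarrow> (TOp i (TRB s) (TRB t),
         TRB (TAdd (TAdd (TOp i s (TRB t)) (TOp i (TRB s) t)) (TSmult lam (TOp i s t))))
        \<in> rb_rel K lam S A"
| var_identity: "\<lbrakk> f \<in> S; range \<sigma> \<subseteq> rb_terms K A; distinct us; set us = supp K f \<rbrakk>
    \<Longrightarrow> (foldr (\<lambda>u. TAdd (TSmult (f u) (term_subst \<sigma> u))) us TZero, TZero) \<in> rb_rel K lam S A"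
| gen_add: "\<lbrakk> a \<in> carrier A; b \<in> carrier A \<rbrakk>
    \<Longrightarrow> (Gen (a \<oplus>\<^bsub>A\<^esub> b), TAdd (Gen a) (Gen b)) \<in> rb_rel K lam S A"
| gen_smult: "\<lbrakk> c \<in> carrier K; a \<in> carrier A \<rbrakk>
    \<Longrightarrow> (Gen (c \<odot>\<^bsub>A\<^esub> a), TSmult c (Gen a)) \<in> rb_rel K lam S A"
| gen_vdash: "\<lbrakk> a \<in> carrier A; b \<in> carrier A \<rbrakk>
    \<Longrightarrow> (Gen (aop A (i, Vdash) a b), TOp i (TRB (Gen a)) (Gen b)) \<in> rb_rel K lam S A"
| gen_dashv: "\<lbrakk> a \<in> carrier A; b \<in> carrier A \<rbrakk>
    \<Longrightarrow> (Gen (aop A (i, Dashv) a b), TOp i (Gen a) (TRB (Gen b))) \<in> rb_rel K lam S A"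
| gen_perp: "\<lbrakk> a \<in> carrier A; b \<in> carrier A \<rbrakk>
    \<Longrightarrow> (Gen (aop A (i, Perp) a b), TSmult lam (TOp i (Gen a) (Gen b))) \<in> rb_rel K lam S A"

text \<open>Each operation is the union of the classes obtained from all choices of representatives;
  as \<open>rb_rel\<close> is a congruence, all these classes are equal.\<close>

definition rb_env :: "('k, 'c) ring_scheme \<Rightarrow> 'k \<Rightarrow> ('k, 'i) npoly set
    \<Rightarrow> ('k, 'a, 'i \<times> tri) omega_alg \<Rightarrow> ('k, ('k, 'i, 'a) rb_term set, 'i) rb_alg" where
  "rb_env K lam S A = (let r = rb_rel K lam S A in
    \<lparr>carrier = rb_terms K A // r,
     mult = undefined,
     one = undefined,
     zero = r `` {TZero},
     add = (\<lambda>X Y. \<Union>s\<in>X. \<Union>t\<in>Y. r `` {TAdd s t}),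
     smult = (\<lambda>c X. \<Union>s\<in>X. r `` {TSmult c s}),
     aop = (\<lambda>i X Y. \<Union>s\<in>X. \<Union>t\<in>Y. r `` {TOp i s t}),
     rbop = (\<lambda>X. \<Union>s\<in>X. r `` {TRB s})\<rparr>)"

definition rb_env_map :: "('k, 'c) ring_scheme \<Rightarrow> 'k \<Rightarrow> ('k, 'i) npoly set
    \<Rightarrow> ('k, 'a, 'i \<times> tri) omega_alg \<Rightarrow> 'a \<Rightarrow> ('k, 'i, 'a) rb_term set" where
  "rb_env_map K lam S A a = rb_rel K lam S A `` {Gen a}"

end

theory Submission
  imports Defs
begin

text \<open>Write \<open>a * b = a \<turnstile> b + a \<stileturn> b + a \<bottom> b\<close>. On the pairs \<open>(a, b) \<in> A \<oplus> A\<close> consider the product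
  \<open>(a, b) \<circ> (c, d) = (a \<bottom> c + a \<stileturn> d + b \<turnstile> c, b * d)\<close> and the operator
  \<open>R (a, b) = (0, \<lambda> (a - b))\<close>. This is a Rota--Baxter algebra of weight \<open>\<lambda>\<close>, and
  \<open>a \<mapsto> (\<lambda>\<inverse> a, 0)\<close> is an injective homomorphism into its tri-dendriform algebra. Injectivity of
  the canonical map then follows by factoring this homomorphism through the universal envelope.

  The identities \<open>f\<close> of the variety hold for the pairs: the first component of \<open>f\<close> is
  multilinear, and on arguments \<open>(a\<^sub>k, 0)\<close> for \<open>k \<in> H\<close> and \<open>(0, a\<^sub>k)\<close> for \<open>k \<notin> H\<close> it is the
  value of \<open>\<Phi>\<^sup>*(f\<^sup>H)\<close>, or \<open>0\<close> if \<open>H\<close> is empty, so it vanishes. The second component depends only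
  on the second components of the arguments, and on diagonal arguments \<open>(b\<^sub>k, b\<^sub>k)\<close> it equals the
  first one.\<close>

section \<open>Evaluation of polynomials\<close>

text \<open>An \<open>npoly\<close> is an arbitrary function; this predicate singles out the
  elements of the free nonassociative algebra over \<open>K\<close>. It covers \<open>star\<close>,
  \<open>Phi_mono\<close> and the sums and products from which they are built, as well as polylinear
  polynomials.\<close>

definition finpoly :: "('k, 'c) ring_scheme \<Rightarrow> ('k, 'i) npoly \<Rightarrow> bool" where
  "finpoly K f \<longleftrightarrow> range f \<subseteq> carrier K \<and> finite (supp K f)"

lemma polylinear_imp_finpoly: "polylinear K n f \<Longrightarrow> finpoly K f"
  by (simp add: polylinear_def finpoly_def)

lemma finpoly_closed: "finpoly K f \<Longrightarrow> f m \<in> carrier K"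
  by (auto simp: finpoly_def)

lemma eval_mono_cong:
  "(\<And>k. k \<in> set (leaves u) \<Longrightarrow> \<sigma> k = \<tau> k) \<Longrightarrow> eval_mono M \<sigma> u = eval_mono M \<tau> u"
  by (induction u) auto

lemma linear_mapsD:
  assumes "h \<in> linear_maps K M N"
  shows "x \<in> carrier M \<Longrightarrow> h x \<in> carrier N"
    and "x \<in> carrier M \<Longrightarrow> y \<in> carrier M \<Longrightarrow> h (x \<oplus>\<^bsub>M\<^esub> y) = h x \<oplus>\<^bsub>N\<^esub> h y"
    and "c \<in> carrier K \<Longrightarrow> x \<in> carrier M \<Longrightarrow> h (c \<odot>\<^bsub>M\<^esub> x) = c \<odot>\<^bsub>N\<^esub> h x"
  using assms by (auto simp: linear_maps_def)

context omega_algebra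
begin

lemma aop_zero_left [simp]: "x \<in> carrier M \<Longrightarrow> aop M i \<zero>\<^bsub>M\<^esub> x = \<zero>\<^bsub>M\<^esub>"
  using aop_smult_left[of "\<zero>\<^bsub>K\<^esub>" "\<zero>\<^bsub>M\<^esub>" x i] by (simp add: aop_closed)

lemma aop_zero_right [simp]: "x \<in> carrier M \<Longrightarrow> aop M i x \<zero>\<^bsub>M\<^esub> = \<zero>\<^bsub>M\<^esub>"
  using aop_smult_right[of "\<zero>\<^bsub>K\<^esub>" x "\<zero>\<^bsub>M\<^esub>" i] by (simp add: aop_closed)

lemma eval_mono_closed:
  "range \<sigma> \<subseteq> carrier M \<Longrightarrow> eval_mono M \<sigma> u \<in> carrier M"
  by (induction u) (auto intro: aop_closed)

text \<open>Coefficients may cancel, so the support of a sum can be smaller than the union of the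
  supports. Monomials with coefficient zero contribute nothing, which allows several polynomials to
  be summed over one common finite set.\<close>

lemma eval_poly_superset:
  assumes "finite F" "supp K f \<subseteq> F" "range f \<subseteq> carrier K" "range \<sigma> \<subseteq> carrier M"
  shows "eval_poly K M \<sigma> f = (\<Oplus>\<^bsub>M\<^esub>u\<in>F. f u \<odot>\<^bsub>M\<^esub> eval_mono M \<sigma> u)"
proof -
  have c: "f u \<odot>\<^bsub>M\<^esub> eval_mono M \<sigma> u \<in> carrier M" for u
    using assms(3,4) eval_mono_closed by (simp add: smult_closed range_subsetD)
  show ?thesis
    unfolding eval_poly_def
  proof (rule M.add.finprod_mono_neutral_cong_left[OF assms(1,2)])
    fix u assume "u \<in> F - supp K f"
    then have "f u = \<zero>\<^bsub>K\<^esub>" by (simp add: supp_def)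
    then show "f u \<odot>\<^bsub>M\<^esub> eval_mono M \<sigma> u = \<zero>\<^bsub>M\<^esub>"
      using eval_mono_closed[OF assms(4)] by simp
  qed (use c in auto)
qed

lemma eval_poly_closed:
  assumes "finpoly K f" "range \<sigma> \<subseteq> carrier M"
  shows "eval_poly K M \<sigma> f \<in> carrier M"
  unfolding eval_poly_def
  using assms eval_mono_closed by (auto simp: finpoly_closed intro!: M.finsum_closed smult_closed)

section \<open>Linearity of evaluation in the polynomial\<close>

lemma finpoly_add:
  assumes "finpoly K f" "finpoly K g"
  shows "finpoly K (\<lambda>m. f m \<oplus> g m)"
proof -
  have "supp K (\<lambda>m. f m \<oplus> g m) \<subseteq> supp K f \<union> supp K g"
    by (auto simp: supp_def)
  then have "finite (supp K (\<lambda>m. f m \<oplus> g m))"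
    using assms finite_subset unfolding finpoly_def by blast
  then show ?thesis
    using assms by (simp add: finpoly_def image_subset_iff)
qed

lemma eval_poly_add:
  assumes "finpoly K f" "finpoly K g" "range \<sigma> \<subseteq> carrier M"
  shows "eval_poly K M \<sigma> (\<lambda>m. f m \<oplus> g m) = eval_poly K M \<sigma> f \<oplus>\<^bsub>M\<^esub> eval_poly K M \<sigma> g"
proof -
  let ?F = "supp K f \<union> supp K g"
  have fin: "finite ?F" and r: "range f \<subseteq> carrier K" "range g \<subseteq> carrier K"
    "range (\<lambda>m. f m \<oplus> g m) \<subseteq> carrier K"
    using assms finpoly_add[OF assms(1,2)] by (simp_all add: finpoly_def)
  have s: "supp K (\<lambda>m. f m \<oplus> g m) \<subseteq> ?F"
    by (auto simp: supp_def)
  have e: "eval_mono M \<sigma> u \<in> carrier M" for u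
    using assms(3) by (rule eval_mono_closed)
  have "eval_poly K M \<sigma> (\<lambda>m. f m \<oplus> g m)
      = (\<Oplus>\<^bsub>M\<^esub>u\<in>?F. f u \<odot>\<^bsub>M\<^esub> eval_mono M \<sigma> u \<oplus>\<^bsub>M\<^esub> g u \<odot>\<^bsub>M\<^esub> eval_mono M \<sigma> u)"
    unfolding eval_poly_superset[OF fin s r(3) assms(3)]
    by (intro M.finsum_cong') (use assms e in \<open>auto simp: finpoly_closed smult_l_distr\<close>)
  also have "\<dots> = eval_poly K M \<sigma> f \<oplus>\<^bsub>M\<^esub> eval_poly K M \<sigma> g"
    unfolding eval_poly_superset[OF fin Un_upper1 r(1) assms(3)]
      eval_poly_superset[OF fin Un_upper2 r(2) assms(3)]
    by (rule M.finsum_addf) (use assms e in \<open>auto simp: finpoly_closed\<close>)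
  finally show ?thesis .
qed

lemma finpoly_smult:
  assumes "finpoly K f" "c \<in> carrier K"
  shows "finpoly K (\<lambda>m. c \<otimes> f m)"
proof -
  have "supp K (\<lambda>m. c \<otimes> f m) \<subseteq> supp K f"
    using assms by (auto simp: supp_def)
  then have "finite (supp K (\<lambda>m. c \<otimes> f m))"
    using assms finite_subset unfolding finpoly_def by blast
  then show ?thesis
    using assms by (simp add: finpoly_def image_subset_iff)
qed

lemma eval_poly_smult:
  assumes "finpoly K f" "c \<in> carrier K" "range \<sigma> \<subseteq> carrier M"
  shows "eval_poly K M \<sigma> (\<lambda>m. c \<otimes> f m) = c \<odot>\<^bsub>M\<^esub> eval_poly K M \<sigma> f"
proof -
  let ?F = "supp K f"
  have fin: "finite ?F" and r: "range (\<lambda>m. c \<otimes> f m) \<subseteq> carrier K"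
    using assms finpoly_smult[OF assms(1,2)] by (simp_all add: finpoly_def)
  have s: "supp K (\<lambda>m. c \<otimes> f m) \<subseteq> ?F"
    using assms by (auto simp: supp_def)
  have e: "eval_mono M \<sigma> u \<in> carrier M" for u
    using assms(3) by (rule eval_mono_closed)
  have "eval_poly K M \<sigma> (\<lambda>m. c \<otimes> f m)
      = (\<Oplus>\<^bsub>M\<^esub>u\<in>?F. c \<odot>\<^bsub>M\<^esub> (f u \<odot>\<^bsub>M\<^esub> eval_mono M \<sigma> u))"
    unfolding eval_poly_superset[OF fin s r assms(3)]
    by (intro M.finsum_cong') (use assms e in \<open>auto simp: finpoly_closed smult_assoc1\<close>)
  also have "\<dots> = c \<odot>\<^bsub>M\<^esub> eval_poly K M \<sigma> f"
    unfolding eval_poly_def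
    by (rule finsum_smult_ldistr[symmetric]) (use assms e fin in \<open>auto simp: finpoly_closed\<close>)
  finally show ?thesis .
qed

text \<open>Finiteness and value are proved together, since the induction step evaluates a sum and
  needs finite support of the part already summed. \<open>Phi\<close> is such a combination of the
  \<open>Phi_mono\<close>.\<close>

lemma finpoly_sum_eval_poly_sum:
  assumes "finite I" "\<And>i. i \<in> I \<Longrightarrow> c i \<in> carrier K" "\<And>i. i \<in> I \<Longrightarrow> finpoly K (g i)"
    "range \<sigma> \<subseteq> carrier M"
  shows "finpoly K (\<lambda>m. \<Oplus>i\<in>I. c i \<otimes> g i m) \<and>
    eval_poly K M \<sigma> (\<lambda>m. \<Oplus>i\<in>I. c i \<otimes> g i m) = (\<Oplus>\<^bsub>M\<^esub>i\<in>I. c i \<odot>\<^bsub>M\<^esub> eval_poly K M \<sigma> (g i))"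
  using assms(1,2,3)
proof (induction I)
  case empty
  show ?case
    by (simp add: finpoly_def supp_def eval_poly_def image_subset_iff)
next
  case (insert j I)
  let ?f = "\<lambda>m. \<Oplus>i\<in>I. c i \<otimes> g i m"
  have eq: "(\<lambda>m. \<Oplus>i\<in>insert j I. c i \<otimes> g i m) = (\<lambda>m. c j \<otimes> g j m \<oplus> ?f m)"
    using insert by (intro ext R.finsum_insert) (auto simp: finpoly_closed)
  have IH: "finpoly K ?f" "eval_poly K M \<sigma> ?f = (\<Oplus>\<^bsub>M\<^esub>i\<in>I. c i \<odot>\<^bsub>M\<^esub> eval_poly K M \<sigma> (g i))"
    using insert by auto
  have j: "finpoly K (\<lambda>m. c j \<otimes> g j m)"
    using insert by (intro finpoly_smult) auto
  have "(\<Oplus>\<^bsub>M\<^esub>i\<in>insert j I. c i \<odot>\<^bsub>M\<^esub> eval_poly K M \<sigma> (g i))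
      = c j \<odot>\<^bsub>M\<^esub> eval_poly K M \<sigma> (g j) \<oplus>\<^bsub>M\<^esub> (\<Oplus>\<^bsub>M\<^esub>i\<in>I. c i \<odot>\<^bsub>M\<^esub> eval_poly K M \<sigma> (g i))"
    using insert assms(4) by (intro M.finsum_insert) (auto intro!: smult_closed eval_poly_closed)
  then show ?case
    unfolding eq using insert.prems assms(4) j IH
    by (simp add: finpoly_add eval_poly_add eval_poly_smult)
qed

section \<open>Evaluation of variables and of products\<close>

lemma finpoly_var_poly: "finpoly K (var_poly K k)"
proof -
  have "supp K (var_poly K k) \<subseteq> {MVar k}"
    by (auto simp: supp_def var_poly_def)
  then show ?thesis
    by (auto simp: finpoly_def var_poly_def intro: finite_subset)
qed

lemma eval_poly_var_poly:
  assumes "range \<sigma> \<subseteq> carrier M"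
  shows "eval_poly K M \<sigma> (var_poly K k) = \<sigma> k"
proof -
  have "eval_poly K M \<sigma> (var_poly K k) = (\<Oplus>\<^bsub>M\<^esub>u\<in>{MVar k}. var_poly K k u \<odot>\<^bsub>M\<^esub> eval_mono M \<sigma> u)"
    by (rule eval_poly_superset) (use assms in \<open>auto simp: supp_def var_poly_def\<close>)
  also have "\<dots> = \<sigma> k"
    using assms by (subst M.finsum_insert) (auto simp: var_poly_def range_subsetD)
  finally show ?thesis .
qed

lemma supp_op_poly:
  assumes "finpoly K f" "finpoly K g"
  shows "supp K (op_poly K j f g) \<subseteq> (\<Union>v\<in>supp K f. MOp j v ` supp K g)"
proof
  fix m assume m: "m \<in> supp K (op_poly K j f g)"
  then obtain v w where vw: "m = MOp j v w" "f v \<otimes> g w \<noteq> \<zero>"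
    by (auto simp: supp_def op_poly_def split: mono.splits if_splits)
  then have "f v \<noteq> \<zero>" "g w \<noteq> \<zero>"
    using assms by (auto simp: finpoly_closed)
  then show "m \<in> (\<Union>v\<in>supp K f. MOp j v ` supp K g)"
    using vw by (auto simp: supp_def)
qed

lemma finpoly_op_poly:
  assumes "finpoly K f" "finpoly K g"
  shows "finpoly K (op_poly K j f g)"
proof -
  have "finite (\<Union>v\<in>supp K f. MOp j v ` supp K g)"
    using assms by (auto simp: finpoly_def)
  then have "finite (supp K (op_poly K j f g))"
    using supp_op_poly[OF assms] finite_subset by blast
  moreover have "op_poly K j f g m \<in> carrier K" for m
    using assms by (simp add: op_poly_def finpoly_closed split: mono.split)
  ultimately show ?thesis
    by (auto simp: finpoly_def)
qed

lemma aop_finsum_left: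
  assumes "finite I" "\<And>v. v \<in> I \<Longrightarrow> x v \<in> carrier M" "y \<in> carrier M"
  shows "aop M j (\<Oplus>\<^bsub>M\<^esub>v\<in>I. x v) y = (\<Oplus>\<^bsub>M\<^esub>v\<in>I. aop M j (x v) y)"
  using assms(1,2)
proof (induction I)
  case (insert v I)
  then have "aop M j (\<Oplus>\<^bsub>M\<^esub>v\<in>insert v I. x v) y = aop M j (x v) y \<oplus>\<^bsub>M\<^esub> aop M j (\<Oplus>\<^bsub>M\<^esub>v\<in>I. x v) y"
    using assms(3) by (simp add: M.finsum_closed Pi_def aop_add_left)
  also have "\<dots> = (\<Oplus>\<^bsub>M\<^esub>v\<in>insert v I. aop M j (x v) y)"
    using insert assms(3) by (subst M.finsum_insert) (auto intro: aop_closed)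
  finally show ?case .
qed (use assms in simp)

lemma aop_finsum_right:
  assumes "finite I" "\<And>v. v \<in> I \<Longrightarrow> x v \<in> carrier M" "y \<in> carrier M"
  shows "aop M j y (\<Oplus>\<^bsub>M\<^esub>v\<in>I. x v) = (\<Oplus>\<^bsub>M\<^esub>v\<in>I. aop M j y (x v))"
  using assms(1,2)
proof (induction I)
  case (insert v I)
  then have "aop M j y (\<Oplus>\<^bsub>M\<^esub>v\<in>insert v I. x v) = aop M j y (x v) \<oplus>\<^bsub>M\<^esub> aop M j y (\<Oplus>\<^bsub>M\<^esub>v\<in>I. x v)"
    using assms(3) by (simp add: M.finsum_closed Pi_def aop_add_right)
  also have "\<dots> = (\<Oplus>\<^bsub>M\<^esub>v\<in>insert v I. aop M j y (x v))"
    using insert assms(3) by (subst M.finsum_insert) (auto intro: aop_closed)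
  finally show ?case .
qed (use assms in simp)

text \<open>The monomial \<open>MOp j v w\<close> comes from the single pair \<open>(v, w)\<close>,
  so its coefficient is one product of coefficients. Evaluation becomes a double sum over the two
  supports, which bilinearity collapses.\<close>

lemma eval_poly_op_poly:
  assumes f: "finpoly K f" and g: "finpoly K g" and \<sigma>: "range \<sigma> \<subseteq> carrier M"
  shows "eval_poly K M \<sigma> (op_poly K j f g) = aop M j (eval_poly K M \<sigma> f) (eval_poly K M \<sigma> g)"
proof -
  let ?e = "eval_mono M \<sigma>"
  have fin: "finite (supp K f)" "finite (supp K g)"
    using f g by (auto simp: finpoly_def)
  have e: "?e u \<in> carrier M" for u
    using \<sigma> by (rule eval_mono_closed)
  note c = finpoly_closed[OF f] finpoly_closed[OF g] e
  let ?t = "\<lambda>m. op_poly K j f g m \<odot>\<^bsub>M\<^esub> ?e m"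
  have t: "?t m \<in> carrier M" for m
    using finpoly_closed[OF finpoly_op_poly[OF f g]] e by (auto intro: smult_closed)
  have "eval_poly K M \<sigma> (op_poly K j f g) = (\<Oplus>\<^bsub>M\<^esub>m\<in>(\<Union>v\<in>supp K f. MOp j v ` supp K g). ?t m)"
    using fin finpoly_op_poly[OF f g] supp_op_poly[OF f g] \<sigma>
    by (intro eval_poly_superset) (auto simp: finpoly_def)
  \<comment> \<open>The constructor \<open>MOp\<close> is injective, so the images for distinct
    \<open>v\<close> are disjoint.\<close>
  also have "\<dots> = (\<Oplus>\<^bsub>M\<^esub>v\<in>supp K f. \<Oplus>\<^bsub>M\<^esub>m\<in>MOp j v ` supp K g. ?t m)"
    using fin t by (intro M.add.finprod_UN_disjoint) (auto simp: pairwise_def disjnt_def)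
  also have "\<dots> = (\<Oplus>\<^bsub>M\<^esub>v\<in>supp K f. \<Oplus>\<^bsub>M\<^esub>w\<in>supp K g. ?t (MOp j v w))"
  proof (rule M.finsum_cong')
    fix v
    show "(\<Oplus>\<^bsub>M\<^esub>m\<in>MOp j v ` supp K g. ?t m) = (\<Oplus>\<^bsub>M\<^esub>w\<in>supp K g. ?t (MOp j v w))"
      using t by (intro M.finsum_reindex) (auto intro!: inj_onI)
  qed (use t in \<open>simp_all add: M.finsum_closed del: eval_mono.simps\<close>)
  also have "\<dots> = (\<Oplus>\<^bsub>M\<^esub>v\<in>supp K f. \<Oplus>\<^bsub>M\<^esub>w\<in>supp K g. aop M j (f v \<odot>\<^bsub>M\<^esub> ?e v) (g w \<odot>\<^bsub>M\<^esub> ?e w))"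
    using c by (intro M.finsum_cong' refl)
      (auto intro!: M.finsum_closed aop_closed smult_closed
        simp: op_poly_def aop_smult_left aop_smult_right aop_closed smult_assoc1[symmetric] m_comm)
  also have "\<dots> = (\<Oplus>\<^bsub>M\<^esub>v\<in>supp K f. aop M j (f v \<odot>\<^bsub>M\<^esub> ?e v) (eval_poly K M \<sigma> g))"
    unfolding eval_poly_def using c fin
    by (intro M.finsum_cong' refl aop_finsum_right[symmetric])
      (auto intro!: M.finsum_closed aop_closed smult_closed)
  also have "\<dots> = aop M j (eval_poly K M \<sigma> f) (eval_poly K M \<sigma> g)"
    unfolding eval_poly_def[of K M \<sigma> f] using c fin eval_poly_closed[OF g \<sigma>]
    by (intro aop_finsum_left[symmetric]) (auto intro: smult_closed)
  finally show ?thesis .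
qed

lemma finpoly_star: "finpoly K (star K u)"
  by (induction u) (auto intro!: finpoly_var_poly finpoly_add finpoly_op_poly)

lemma finpoly_Phi_mono: "finpoly K (Phi_mono K u H)"
  by (induction u arbitrary: H)
    (auto intro!: finpoly_var_poly finpoly_op_poly finpoly_star simp: Let_def)

text \<open>Meant for the two projections of the double. The first component of a product there also
  involves the second components of the factors, so \<open>h\<close> is applied to the values of
  whole monomials, not to their arguments.\<close>

lemma linear_map_eval_poly:
  assumes N: "module K N" and h: "h \<in> linear_maps K M N" and f: "finpoly K f"
    and \<sigma>: "range \<sigma> \<subseteq> carrier M"
  shows "h (eval_poly K M \<sigma> f) = (\<Oplus>\<^bsub>N\<^esub>u\<in>supp K f. f u \<odot>\<^bsub>N\<^esub> h (eval_mono M \<sigma> u))"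
proof -
  interpret N: module K N by (rule N)
  have e: "eval_mono M \<sigma> u \<in> carrier M" for u
    using \<sigma> by (rule eval_mono_closed)
  note c = finpoly_closed[OF f] e linear_mapsD(1)[OF h e]
  have h0: "h \<zero>\<^bsub>M\<^esub> = \<zero>\<^bsub>N\<^esub>"
    using linear_mapsD(3)[OF h, of \<zero> "\<zero>\<^bsub>M\<^esub>"] linear_mapsD(1)[OF h, of "\<zero>\<^bsub>M\<^esub>"] by simp
  have "h (\<Oplus>\<^bsub>M\<^esub>u\<in>F. f u \<odot>\<^bsub>M\<^esub> eval_mono M \<sigma> u) = (\<Oplus>\<^bsub>N\<^esub>u\<in>F. f u \<odot>\<^bsub>N\<^esub> h (eval_mono M \<sigma> u))"
    if "finite F" for F
    using that
  proof (induction F)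
    case (insert u F)
    have "(\<Oplus>\<^bsub>M\<^esub>u\<in>F. f u \<odot>\<^bsub>M\<^esub> eval_mono M \<sigma> u) \<in> carrier M"
      using c by (auto intro!: M.finsum_closed)
    then show ?case
      using insert c
      by (simp add: Pi_def linear_mapsD[OF h])
  qed (simp add: h0)
  then show ?thesis
    using f by (auto simp: eval_poly_def finpoly_def)
qed

end

section \<open>The double of a tri-dendriform algebra\<close>

text \<open>The product \<open>*\<close> on the second components; \<open>star\<close> replaces each
  operation symbol by this sum.\<close>

definition tot :: "('k, 'a, 'i \<times> tri, 'd) omega_alg_scheme \<Rightarrow> 'i \<Rightarrow> 'a \<Rightarrow> 'a \<Rightarrow> 'a" where
  "tot A i x y = aop A (i, Vdash) x y \<oplus>\<^bsub>A\<^esub> aop A (i, Dashv) x y \<oplus>\<^bsub>A\<^esub> aop A (i, Perp) x y"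

text \<open>The pairs \<open>(a, 0)\<close> form an ideal with product \<bottom>, the pairs
  \<open>(0, b)\<close> a subalgebra with product \<open>*\<close>, and mixed products are given by
  \<turnstile> and \<stileturn>. The diagonal is a subalgebra complementary to the pairs
  \<open>(0, b)\<close>. The operator is minus \<open>lam\<close> times the projection onto the
  pairs \<open>(0, b)\<close> along the diagonal, the usual Rota--Baxter operator of an algebra
  split into two subalgebras.\<close>

definition double :: "'k \<Rightarrow> ('k, 'a, 'i \<times> tri, 'd) omega_alg_scheme \<Rightarrow> ('k, 'a \<times> 'a, 'i) rb_alg" where
  "double lam A = \<lparr>carrier = carrier A \<times> carrier A, mult = undefined, one = undefined,
     zero = (\<zero>\<^bsub>A\<^esub>, \<zero>\<^bsub>A\<^esub>),
     add = (\<lambda>x y. (fst x \<oplus>\<^bsub>A\<^esub> fst y, snd x \<oplus>\<^bsub>A\<^esub> snd y)),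
     smult = (\<lambda>c x. (c \<odot>\<^bsub>A\<^esub> fst x, c \<odot>\<^bsub>A\<^esub> snd x)),
     aop = (\<lambda>i x y. (aop A (i, Perp) (fst x) (fst y) \<oplus>\<^bsub>A\<^esub> aop A (i, Dashv) (fst x) (snd y)
       \<oplus>\<^bsub>A\<^esub> aop A (i, Vdash) (snd x) (fst y), tot A i (snd x) (snd y))),
     rbop = (\<lambda>x. (\<zero>\<^bsub>A\<^esub>, lam \<odot>\<^bsub>A\<^esub> (fst x \<ominus>\<^bsub>A\<^esub> snd x)))\<rparr>"

lemma double_simps [simp]:
  "carrier (double lam A) = carrier A \<times> carrier A"
  "zero (double lam A) = (\<zero>\<^bsub>A\<^esub>, \<zero>\<^bsub>A\<^esub>)"
  "x \<oplus>\<^bsub>double lam A\<^esub> y = (fst x \<oplus>\<^bsub>A\<^esub> fst y, snd x \<oplus>\<^bsub>A\<^esub> snd y)"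
  "c \<odot>\<^bsub>double lam A\<^esub> x = (c \<odot>\<^bsub>A\<^esub> fst x, c \<odot>\<^bsub>A\<^esub> snd x)"
  "aop (double lam A) i x y = (aop A (i, Perp) (fst x) (fst y) \<oplus>\<^bsub>A\<^esub> aop A (i, Dashv) (fst x) (snd y)
     \<oplus>\<^bsub>A\<^esub> aop A (i, Vdash) (snd x) (fst y), tot A i (snd x) (snd y))"
  "rbop (double lam A) x = (\<zero>\<^bsub>A\<^esub>, lam \<odot>\<^bsub>A\<^esub> (fst x \<ominus>\<^bsub>A\<^esub> snd x))"
  by (simp_all add: double_def)

text \<open>The clauses for \<turnstile> and \<stileturn> pass \<open>H\<close> on unchanged, while
  the clause for \<bottom> restricts it. As only the variables that occur matter, one fixed
  \<open>H\<close> can be kept throughout an induction on monomials.\<close>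

lemma Phi_mono_cong:
  "H \<inter> set (leaves u) = H' \<inter> set (leaves u) \<Longrightarrow> Phi_mono K u H = Phi_mono K u H'"
proof (induction u arbitrary: H H')
  case (MOp i v w)
  have eq: "H \<inter> set (leaves v) = H' \<inter> set (leaves v)" "H \<inter> set (leaves w) = H' \<inter> set (leaves w)"
    using MOp.prems by auto
  show ?case
    using MOp.IH(1)[OF eq(1)] MOp.IH(2)[OF eq(2)] by (simp add: Let_def eq)
qed simp

locale tri_omega_algebra = omega_algebra K A
  for K :: "('k, 'c) ring_scheme" (structure)
  and A :: "('k, 'a, 'i \<times> tri) omega_alg" (structure)
begin

lemmas add_assoc = M.add.m_assoc
lemmas add_comm = M.add.m_comm
lemmas add_lcomm = M.add.m_lcomm

lemma tot_closed: "x \<in> carrier A \<Longrightarrow> y \<in> carrier A \<Longrightarrow> tot A i x y \<in> carrier A"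
  by (simp add: tot_def aop_closed)

lemma tot_add_left:
  "\<lbrakk>x \<in> carrier A; y \<in> carrier A; z \<in> carrier A\<rbrakk>
    \<Longrightarrow> tot A i (x \<oplus>\<^bsub>A\<^esub> y) z = tot A i x z \<oplus>\<^bsub>A\<^esub> tot A i y z"
  by (simp add: tot_def aop_add_left aop_closed add_assoc add_lcomm)

lemma tot_add_right:
  "\<lbrakk>x \<in> carrier A; y \<in> carrier A; z \<in> carrier A\<rbrakk>
    \<Longrightarrow> tot A i x (y \<oplus>\<^bsub>A\<^esub> z) = tot A i x y \<oplus>\<^bsub>A\<^esub> tot A i x z"
  by (simp add: tot_def aop_add_right aop_closed add_assoc add_lcomm)

lemma tot_smult_left:
  "\<lbrakk>c \<in> carrier K; x \<in> carrier A; y \<in> carrier A\<rbrakk>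
    \<Longrightarrow> tot A i (c \<odot>\<^bsub>A\<^esub> x) y = c \<odot>\<^bsub>A\<^esub> tot A i x y"
  by (simp add: tot_def aop_smult_left aop_closed smult_r_distr)

lemma tot_smult_right:
  "\<lbrakk>c \<in> carrier K; x \<in> carrier A; y \<in> carrier A\<rbrakk>
    \<Longrightarrow> tot A i x (c \<odot>\<^bsub>A\<^esub> y) = c \<odot>\<^bsub>A\<^esub> tot A i x y"
  by (simp add: tot_def aop_smult_right aop_closed smult_r_distr)

lemma tot_zero [simp]:
  "x \<in> carrier A \<Longrightarrow> tot A i \<zero>\<^bsub>A\<^esub> x = \<zero>\<^bsub>A\<^esub>"
  "x \<in> carrier A \<Longrightarrow> tot A i x \<zero>\<^bsub>A\<^esub> = \<zero>\<^bsub>A\<^esub>"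
  by (simp_all add: tot_def)

lemma omega_algebra_double: "omega_algebra K (double lam A)"
proof -
  have ag: "abelian_group (double lam A)"
  proof (rule abelian_groupI)
    fix x assume "x \<in> carrier (double lam A)"
    then show "\<exists>y\<in>carrier (double lam A). y \<oplus>\<^bsub>double lam A\<^esub> x = \<zero>\<^bsub>double lam A\<^esub>"
      by (intro bexI[of _ "(\<ominus>\<^bsub>A\<^esub> fst x, \<ominus>\<^bsub>A\<^esub> snd x)"]) (auto simp: M.l_neg)
  qed (auto simp: add_assoc add_comm add_lcomm)
  interpret D: module K "double lam A"
    by (rule moduleI[OF R.is_cring ag])
      (auto simp: smult_l_distr smult_r_distr smult_assoc1)
  show ?thesis
    by unfold_locales
      (auto simp: aop_closed tot_closed aop_add_left aop_add_right aop_smult_left aop_smult_right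
        tot_add_left tot_add_right tot_smult_left tot_smult_right smult_r_distr
        add_assoc add_lcomm)
qed

section \<open>Values of monomials on the double\<close>

lemma fst_linear: "fst \<in> linear_maps K (double lam A) A"
  and snd_linear: "snd \<in> linear_maps K (double lam A) A"
  by (auto simp: linear_maps_def)

text \<open>The second component of a product is \<open>tot\<close> of the second components, and
  the recursion of \<open>star\<close> is that of \<open>tot\<close>.\<close>

lemma snd_eval_mono_double:
  assumes "range \<tau> \<subseteq> carrier A \<times> carrier A" "range \<sigma> \<subseteq> carrier A" "snd \<circ> \<tau> = \<sigma>"
  shows "snd (eval_mono (double lam A) \<tau> u) = eval_poly K A \<sigma> (star K u)"
proof (induction u)
  case (MVar k)
  show ?case
    using assms by (auto simp: eval_poly_var_poly)
next
  case (MOp i v w)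
  then show ?case
    using assms(2)
    by (simp add: tot_def eval_poly_add eval_poly_op_poly finpoly_add finpoly_op_poly finpoly_star)
qed

text \<open>For diagonal factors the first component of the product has the same three summands as
  \<open>tot\<close>, in another order, so the two components stay equal.\<close>

lemma eval_mono_double_diagonal:
  assumes "range \<sigma> \<subseteq> carrier A"
  shows "eval_mono (double lam A) (\<lambda>k. (\<sigma> k, \<sigma> k)) u
    = (eval_poly K A \<sigma> (star K u), eval_poly K A \<sigma> (star K u))"
proof (induction u)
  case (MVar k)
  show ?case
    using assms by (auto simp: eval_poly_var_poly)
next
  case (MOp i v w)
  then show ?case
    using assms
    by (simp add: tot_def eval_poly_add eval_poly_op_poly finpoly_add finpoly_op_poly finpoly_star
        aop_closed eval_poly_closed add_assoc add_comm add_lcomm)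
qed

text \<open>A factor without variables of \<open>H\<close> has a value \<open>(0, x)\<close>
  computed by \<open>star\<close>, a factor with such variables a value \<open>(x, 0)\<close>. In
  the double, products of such pairs are given by \<bottom>, \<turnstile>, \<stileturn> in exactly
  the cases of the recursion of \<open>Phi_mono\<close>; two factors of the first kind multiply by
  \<open>tot\<close>, as in \<open>star\<close>.\<close>

lemma eval_mono_double_pure:
  assumes "range a \<subseteq> carrier A"
  shows "eval_mono (double lam A) (\<lambda>k. if k \<in> H then (a k, \<zero>\<^bsub>A\<^esub>) else (\<zero>\<^bsub>A\<^esub>, a k)) u =
    (if H \<inter> set (leaves u) = {} then (\<zero>\<^bsub>A\<^esub>, eval_poly K A a (star K u))
     else (eval_poly K A a (Phi_mono K u H), \<zero>\<^bsub>A\<^esub>))"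
proof (induction u)
  case (MVar k)
  show ?case
    using assms by (auto simp: eval_poly_var_poly)
next
  case (MOp i v w)
  have r: "Phi_mono K v (H \<inter> set (leaves v)) = Phi_mono K v H"
    "Phi_mono K w (H \<inter> set (leaves w)) = Phi_mono K w H"
    by (rule Phi_mono_cong; blast)+
  have c: "eval_poly K A a (star K u) \<in> carrier A" "eval_poly K A a (Phi_mono K u H) \<in> carrier A" for u
    using assms by (simp_all add: eval_poly_closed finpoly_star finpoly_Phi_mono)
  have *: "eval_poly K A a (star K (MOp i v w))
      = tot A i (eval_poly K A a (star K v)) (eval_poly K A a (star K w))"
    using assms
    by (simp add: tot_def eval_poly_add eval_poly_op_poly finpoly_add finpoly_op_poly finpoly_star)
  consider "H \<inter> set (leaves v) = {}" "H \<inter> set (leaves w) = {}"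
    | "H \<inter> set (leaves v) = {}" "H \<inter> set (leaves w) \<noteq> {}"
    | "H \<inter> set (leaves v) \<noteq> {}" "H \<inter> set (leaves w) = {}"
    | "H \<inter> set (leaves v) \<noteq> {}" "H \<inter> set (leaves w) \<noteq> {}"
    by blast
  then show ?case
  proof cases
    case 1
    then show ?thesis
      using MOp c by (simp only: eval_mono.simps double_simps *) (simp add: Int_Un_distrib)
  next
    case 2
    then show ?thesis
      using MOp c assms
      by (simp add: r Int_Un_distrib Let_def eval_poly_op_poly finpoly_star finpoly_Phi_mono
          aop_closed)
  next
    case 3
    then show ?thesis
      using MOp c assms
      by (simp add: r Int_Un_distrib Let_def eval_poly_op_poly finpoly_star finpoly_Phi_mono
          aop_closed tot_def)
  next
    case 4
    then show ?thesis
      using MOp c assms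
      by (simp add: r Int_Un_distrib Let_def eval_poly_op_poly finpoly_star finpoly_Phi_mono
          aop_closed)
  qed
qed

end

section \<open>Additivity of polylinear polynomials in each argument\<close>

context omega_algebra
begin

text \<open>The variable \<open>k\<close> occurs exactly once, hence in only one factor of a
  product. The other factor keeps its value, and the operation is additive in the factor that
  changes.\<close>

lemma eval_mono_fun_upd_add:
  assumes "distinct (leaves u)" "k \<in> set (leaves u)" "range \<sigma> \<subseteq> carrier M"
    "x \<in> carrier M" "y \<in> carrier M"
  shows "eval_mono M (\<sigma>(k := x \<oplus>\<^bsub>M\<^esub> y)) u
    = eval_mono M (\<sigma>(k := x)) u \<oplus>\<^bsub>M\<^esub> eval_mono M (\<sigma>(k := y)) u"
  using assms(1,2)
proof (induction u)
  case (MOp i v w)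
  have c: "eval_mono M (\<sigma>(k := z)) t \<in> carrier M" if "z \<in> carrier M" for z t
    using assms(3) that by (intro eval_mono_closed) auto
  have other: "eval_mono M (\<sigma>(k := z)) t = eval_mono M \<sigma> t" if "k \<notin> set (leaves t)" for z t
    using that by (intro eval_mono_cong) auto
  have c0: "eval_mono M \<sigma> t \<in> carrier M" for t
    using assms(3) by (rule eval_mono_closed)
  show ?case
  proof (cases "k \<in> set (leaves v)")
    case True
    then have "k \<notin> set (leaves w)"
      using MOp.prems by auto
    then show ?thesis
      using MOp True assms(4,5) c c0 other[of w] by (simp add: aop_add_left del: fun_upd_apply)
  next
    case False
    then show ?thesis
      using MOp assms(4,5) c c0 other[of v] by (simp add: aop_add_right del: fun_upd_apply)
  qed
qed simp

lemma eval_poly_fun_upd_add: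
  assumes f: "polylinear K n f" and "k \<in> {1..n}" and \<sigma>: "range \<sigma> \<subseteq> carrier M"
    and x: "x \<in> carrier M" and y: "y \<in> carrier M"
  shows "eval_poly K M (\<sigma>(k := x \<oplus>\<^bsub>M\<^esub> y)) f
    = eval_poly K M (\<sigma>(k := x)) f \<oplus>\<^bsub>M\<^esub> eval_poly K M (\<sigma>(k := y)) f"
proof -
  have c: "eval_mono M (\<sigma>(k := z)) t \<in> carrier M" if "z \<in> carrier M" for z t
    using \<sigma> that by (intro eval_mono_closed) auto
  have fc: "f u \<in> carrier K" for u
    using f by (intro finpoly_closed polylinear_imp_finpoly)
  have "eval_poly K M (\<sigma>(k := x \<oplus>\<^bsub>M\<^esub> y)) f = (\<Oplus>\<^bsub>M\<^esub>u\<in>supp K f.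
      f u \<odot>\<^bsub>M\<^esub> eval_mono M (\<sigma>(k := x)) u \<oplus>\<^bsub>M\<^esub> f u \<odot>\<^bsub>M\<^esub> eval_mono M (\<sigma>(k := y)) u)"
    unfolding eval_poly_def
  proof (rule M.finsum_cong')
    fix u assume "u \<in> supp K f"
    \<comment> \<open>Polylinearity puts \<open>k\<close> into every monomial of the support; a
      monomial without it would be counted twice on the right.\<close>
    then have "distinct (leaves u)" "k \<in> set (leaves u)"
      using assms(2) f by (auto simp: polylinear_def)
    then show "f u \<odot>\<^bsub>M\<^esub> eval_mono M (\<sigma>(k := x \<oplus>\<^bsub>M\<^esub> y)) u =
        f u \<odot>\<^bsub>M\<^esub> eval_mono M (\<sigma>(k := x)) u \<oplus>\<^bsub>M\<^esub> f u \<odot>\<^bsub>M\<^esub> eval_mono M (\<sigma>(k := y)) u"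
      using \<sigma> x y c fc by (simp add: eval_mono_fun_upd_add smult_r_distr)
  qed (use x y c fc in auto)
  also have "\<dots> = eval_poly K M (\<sigma>(k := x)) f \<oplus>\<^bsub>M\<^esub> eval_poly K M (\<sigma>(k := y)) f"
    unfolding eval_poly_def by (rule M.finsum_addf) (use x y c fc in auto)
  finally show ?thesis .
qed

end

section \<open>The identities of the variety on the double\<close>

context tri_omega_algebra
begin

lemma eval_poly_Phi:
  assumes "finpoly K f" "range a \<subseteq> carrier A"
  shows "eval_poly K A a (Phi K f H) = (\<Oplus>\<^bsub>A\<^esub>u\<in>supp K f. f u \<odot>\<^bsub>A\<^esub> eval_poly K A a (Phi_mono K u H))"
  unfolding Phi_def using assms
  by (intro finpoly_sum_eval_poly_sum[THEN conjunct2] finpoly_Phi_mono finpoly_closed)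
    (auto simp: finpoly_def)

lemma fst_eval_poly_double_pure:
  assumes f: "polylinear K n f"
    and dend: "\<And>H. H \<noteq> {} \<Longrightarrow> H \<subseteq> {1..n} \<Longrightarrow> satisfies K A (Phi K f H)"
    and \<sigma>: "range \<sigma> \<subseteq> carrier A \<times> carrier A"
    and pure: "\<And>k. k \<in> {1..n} \<Longrightarrow> fst (\<sigma> k) = \<zero>\<^bsub>A\<^esub> \<or> snd (\<sigma> k) = \<zero>\<^bsub>A\<^esub>"
  shows "fst (eval_poly K (double lam A) \<sigma> f) = \<zero>\<^bsub>A\<^esub>"
proof -
  interpret D: omega_algebra K "double lam A"
    by (rule omega_algebra_double)
  \<comment> \<open>An argument \<open>(0, 0)\<close> is of both kinds and is counted as
    \<open>(0, b)\<close>. Restricting to \<open>{1..n}\<close> makes \<open>dend\<close> applicable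
    to \<open>H\<close>.\<close>
  define H where "H = {k \<in> {1..n}. fst (\<sigma> k) \<noteq> \<zero>\<^bsub>A\<^esub>}"
  define a where "a k = (if k \<in> H then fst (\<sigma> k) else snd (\<sigma> k))" for k
  have \<sigma>': "fst (\<sigma> k) \<in> carrier A" "snd (\<sigma> k) \<in> carrier A" for k
    using \<sigma> by (auto simp: image_subset_iff mem_Times_iff)
  then have a: "range a \<subseteq> carrier A"
    by (auto simp: a_def)
  have fp: "finpoly K f"
    using f by (rule polylinear_imp_finpoly)
  have H: "H \<subseteq> {1..n}"
    by (auto simp: H_def)
  have ev: "fst (eval_mono (double lam A) \<sigma> u)
      = (if H = {} then \<zero>\<^bsub>A\<^esub> else eval_poly K A a (Phi_mono K u H))" if "u \<in> supp K f" for u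
  proof -
    have l: "set (leaves u) = {1..n}"
      using f that by (simp add: polylinear_def)
    \<comment> \<open>Indices outside \<open>{1..n}\<close> do not occur in \<open>u\<close>, so
      mixed values of \<open>\<sigma>\<close> there do no harm.\<close>
    have "eval_mono (double lam A) \<sigma> u
        = eval_mono (double lam A) (\<lambda>k. if k \<in> H then (a k, \<zero>\<^bsub>A\<^esub>) else (\<zero>\<^bsub>A\<^esub>, a k)) u"
      using l pure by (intro eval_mono_cong) (auto simp: a_def H_def prod_eq_iff)
    then show ?thesis
      using H by (auto simp: eval_mono_double_pure[OF a] l Int_absorb2)
  qed
  have ec: "eval_poly K A a (Phi_mono K u H) \<in> carrier A" for u
    using a by (simp add: eval_poly_closed finpoly_Phi_mono)
  have "fst (eval_poly K (double lam A) \<sigma> f)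
      = (\<Oplus>\<^bsub>A\<^esub>u\<in>supp K f. f u \<odot>\<^bsub>A\<^esub> fst (eval_mono (double lam A) \<sigma> u))"
    using \<sigma> fp by (intro D.linear_map_eval_poly fst_linear module_axioms) auto
  also have "\<dots> = (\<Oplus>\<^bsub>A\<^esub>u\<in>supp K f. f u \<odot>\<^bsub>A\<^esub> (if H = {} then \<zero>\<^bsub>A\<^esub> else eval_poly K A a (Phi_mono K u H)))"
    using fp ec by (intro M.finsum_cong') (auto simp: ev finpoly_closed)
  also have "\<dots> = \<zero>\<^bsub>A\<^esub>"
  proof (cases "H = {}")
    case True
    then show ?thesis
      using fp by (auto simp: finpoly_closed intro!: M.add.finprod_one_eqI)
  next
    case False
    then show ?thesis
      using dend[OF False H] a eval_poly_Phi[OF fp a, of H] by (simp add: satisfies_def)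
  qed
  finally show ?thesis .
qed

text \<open>Additivity allows an argument \<open>(x, y)\<close> to be split into
  \<open>(x, 0)\<close> and \<open>(0, y)\<close>. Doing so at every index reduces the claim to pure
  arguments.\<close>

lemma fst_eval_poly_double:
  assumes f: "polylinear K n f"
    and dend: "\<And>H. H \<noteq> {} \<Longrightarrow> H \<subseteq> {1..n} \<Longrightarrow> satisfies K A (Phi K f H)"
    and \<sigma>: "range \<sigma> \<subseteq> carrier A \<times> carrier A"
  shows "fst (eval_poly K (double lam A) \<sigma> f) = \<zero>\<^bsub>A\<^esub>"
proof -
  interpret D: omega_algebra K "double lam A"
    by (rule omega_algebra_double)
  \<comment> \<open>The set \<open>F\<close> contains all indices whose argument may be mixed. The
    assignment varies in the induction, because splitting at one index changes it.\<close>
  have "fst (eval_poly K (double lam A) \<sigma> f) = \<zero>\<^bsub>A\<^esub>"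
    if "finite F" "F \<subseteq> {1..n}" "range \<sigma> \<subseteq> carrier A \<times> carrier A"
      "\<And>k. k \<in> {1..n} - F \<Longrightarrow> fst (\<sigma> k) = \<zero>\<^bsub>A\<^esub> \<or> snd (\<sigma> k) = \<zero>\<^bsub>A\<^esub>"
    for F and \<sigma> :: "nat \<Rightarrow> 'a \<times> 'a"
    using that
  proof (induction F arbitrary: \<sigma>)
    case empty
    then show ?case
      by (intro fst_eval_poly_double_pure[OF f dend]) auto
  next
    case (insert k F)
    define x y where "x = (fst (\<sigma> k), \<zero>\<^bsub>A\<^esub>)" and "y = (\<zero>\<^bsub>A\<^esub>, snd (\<sigma> k))"
    have k: "fst (\<sigma> k) \<in> carrier A" "snd (\<sigma> k) \<in> carrier A"
      using insert.prems(2) by (auto simp: image_subset_iff mem_Times_iff)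
    have xy: "x \<in> carrier A \<times> carrier A" "y \<in> carrier A \<times> carrier A"
      using k by (auto simp: x_def y_def)
    have "\<sigma> = \<sigma>(k := x \<oplus>\<^bsub>double lam A\<^esub> y)"
      using k by (auto simp: x_def y_def)
    then have "eval_poly K (double lam A) \<sigma> f
        = eval_poly K (double lam A) (\<sigma>(k := x \<oplus>\<^bsub>double lam A\<^esub> y)) f"
      by simp
    also have "\<dots> = eval_poly K (double lam A) (\<sigma>(k := x)) f
        \<oplus>\<^bsub>double lam A\<^esub> eval_poly K (double lam A) (\<sigma>(k := y)) f"
      using insert.prems xy by (intro D.eval_poly_fun_upd_add[OF f]) auto
    finally have "eval_poly K (double lam A) \<sigma> f
        = eval_poly K (double lam A) (\<sigma>(k := x)) f
        \<oplus>\<^bsub>double lam A\<^esub> eval_poly K (double lam A) (\<sigma>(k := y)) f" .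
    moreover  have "fst (eval_poly K (double lam A) (\<sigma>(k := x)) f) = \<zero>\<^bsub>A\<^esub>"
      by (rule insert.IH) (use insert.prems xy in \<open>auto simp: x_def\<close>)
    moreover  have "fst (eval_poly K (double lam A) (\<sigma>(k := y)) f) = \<zero>\<^bsub>A\<^esub>"
      by (rule insert.IH) (use insert.prems xy in \<open>auto simp: y_def\<close>)
    ultimately show ?case
      by simp
  qed
  \<comment> \<open>For \<open>F = {1..n}\<close> the purity condition is vacuous.\<close>
  from this[of "{1..n}" \<sigma>] \<sigma> show ?thesis
    by auto
qed

lemma satisfies_double:
  assumes f: "polylinear K n f"
    and dend: "\<And>H. H \<noteq> {} \<Longrightarrow> H \<subseteq> {1..n} \<Longrightarrow> satisfies K A (Phi K f H)"
  shows "satisfies K (double lam A) f"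
  unfolding satisfies_def
proof (intro allI impI)
  interpret D: omega_algebra K "double lam A"
    by (rule omega_algebra_double)
  fix \<sigma> :: "nat \<Rightarrow> 'a \<times> 'a"
  assume "range \<sigma> \<subseteq> carrier (double lam A)"
  then have \<sigma>: "range \<sigma> \<subseteq> carrier A \<times> carrier A"
    by simp
  define b where "b = snd \<circ> \<sigma>"
  have b: "range b \<subseteq> carrier A"
    using \<sigma> by (auto simp: b_def image_subset_iff mem_Times_iff)
  have diag: "range (\<lambda>k. (b k, b k)) \<subseteq> carrier A \<times> carrier A"
    using b by auto
  have fp: "finpoly K f"
    using f by (rule polylinear_imp_finpoly)
  have "snd (eval_poly K (double lam A) \<sigma> f)
      = (\<Oplus>\<^bsub>A\<^esub>u\<in>supp K f. f u \<odot>\<^bsub>A\<^esub> eval_poly K A b (star K u))"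
    using \<sigma> b by (subst D.linear_map_eval_poly[OF module_axioms snd_linear fp])
      (simp_all add: snd_eval_mono_double[OF \<sigma> b b_def[symmetric]])
  \<comment> \<open>At diagonal arguments the first component of each monomial is given by
    \<open>star\<close> too, so the same sum arises as a first component, which is already known to
    vanish.\<close>
  also have "\<dots> = fst (eval_poly K (double lam A) (\<lambda>k. (b k, b k)) f)"
    using diag b by (subst D.linear_map_eval_poly[OF module_axioms fst_linear fp])
      (auto simp: eval_mono_double_diagonal)
  also have "\<dots> = \<zero>\<^bsub>A\<^esub>"
    by (rule fst_eval_poly_double[OF f dend diag])
  finally show "eval_poly K (double lam A) \<sigma> f = \<zero>\<^bsub>double lam A\<^esub>"
    using fst_eval_poly_double[OF f dend \<sigma>] by (simp add: prod_eq_iff)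
qed

section \<open>The Rota--Baxter structure of the double and the embedding of
  \<open>A\<close>\<close>

lemma rb_var_algebra_double:
  assumes lam: "lam \<in> carrier K" and S: "\<forall>f\<in>S. \<exists>n. polylinear K n f"
    and dend: "tri_dendriform K S A"
  shows "rb_var_algebra K lam S (double lam A)"
  unfolding rb_var_algebra_def
proof (intro conjI allI ballI)
  show "var_algebra K S (double lam A)"
    unfolding var_algebra_def
  proof (intro conjI ballI omega_algebra_double)
    fix f assume "f \<in> S"
    then obtain n where "polylinear K n f"
      using S by blast
    moreover from this have "satisfies K A (Phi K f H)" if "H \<noteq> {}" "H \<subseteq> {1..n}" for H
      using dend \<open>f \<in> S\<close> that unfolding tri_dendriform_def by blast
    ultimately show "satisfies K (double lam A) f"
      by (rule satisfies_double)
  qed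
  show "rbop (double lam A) \<in> linear_maps K (double lam A) (double lam A)"
    using lam
    by (auto simp: linear_maps_def M.minus_eq smult_r_distr smult_r_minus M.minus_add
        smult_assoc1[symmetric] R.m_comm add_assoc add_lcomm)
next
  fix i x y
  assume "x \<in> carrier (double lam A)" "y \<in> carrier (double lam A)"
  then obtain a b c d where xy: "x = (a, b)" "y = (c, d)"
    and abcd: "a \<in> carrier A" "b \<in> carrier A" "c \<in> carrier A" "d \<in> carrier A"
    by auto
  \<comment> \<open>The operator sends \<open>x\<close> to \<open>(0, lam p)\<close> and
    \<open>y\<close> to \<open>(0, lam q)\<close>.\<close>
  define p q where "p = a \<ominus>\<^bsub>A\<^esub> b" and "q = c \<ominus>\<^bsub>A\<^esub> d"
  have pq: "p \<in> carrier A" "q \<in> carrier A"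
    using abcd by (auto simp: p_def q_def)
  have ac: "a = p \<oplus>\<^bsub>A\<^esub> b" "c = q \<oplus>\<^bsub>A\<^esub> d"
    using abcd by (auto simp: p_def q_def M.minus_eq add_assoc M.l_neg)
  let ?op = "\<lambda>t. aop A (i, t)"
  let ?D = "double lam A"
  have tot: "tot A i x y \<in> carrier A" if "x \<in> carrier A" "y \<in> carrier A" for x y
    using that by (rule tot_closed)
  \<comment> \<open>The argument of the operator on the right of the Rota--Baxter identity has the
    components \<open>lam l\<close> and \<open>lam r\<close>.\<close>
  define l r where "l = ?op Dashv a q \<oplus>\<^bsub>A\<^esub> ?op Vdash p c \<oplus>\<^bsub>A\<^esub>
      (?op Perp a c \<oplus>\<^bsub>A\<^esub> ?op Dashv a d \<oplus>\<^bsub>A\<^esub> ?op Vdash b c)"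
    and "r = tot A i b q \<oplus>\<^bsub>A\<^esub> tot A i p d \<oplus>\<^bsub>A\<^esub> tot A i b d"
  have lr: "l \<in> carrier A" "r \<in> carrier A"
    using abcd pq by (auto simp: l_def r_def aop_closed tot_closed)
  \<comment> \<open>With \<open>a = p + b\<close> and \<open>c = q + d\<close>, the terms of
    \<open>l\<close> in \<stileturn> add up to a \<stileturn> c and those in \<turnstile> to a
    \<turnstile> c. Expanding \<open>a * c\<close> then gives \<open>p * q\<close> plus
    \<open>r\<close>, so \<open>l - r\<close> is \<open>p * q\<close>, and both sides of the
    identity become \<open>(0, lam (lam (p * q)))\<close>.\<close>
  have "l = tot A i a c"
    using abcd(2,4) pq unfolding l_def ac
    by (simp add: tot_def aop_add_left aop_add_right aop_closed add_assoc add_comm add_lcomm)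
  also have "\<dots> = tot A i p q \<oplus>\<^bsub>A\<^esub> r"
    using abcd(2,4) pq unfolding r_def ac
    by (simp add: tot_add_left tot_add_right tot_closed add_assoc add_comm add_lcomm)
  finally have "l \<ominus>\<^bsub>A\<^esub> r = tot A i p q"
    using lr tot pq by (simp add: M.minus_eq add_assoc M.r_neg)
  moreover have "aop ?D i x (rbop ?D y) \<oplus>\<^bsub>?D\<^esub> aop ?D i (rbop ?D x) y \<oplus>\<^bsub>?D\<^esub> lam \<odot>\<^bsub>?D\<^esub> aop ?D i x y
      = (lam \<odot>\<^bsub>A\<^esub> l, lam \<odot>\<^bsub>A\<^esub> r)"
    using abcd pq lam unfolding xy l_def r_def
    by (simp add: p_def[symmetric] q_def[symmetric] aop_smult_left aop_smult_right
        tot_smult_left tot_smult_right aop_closed tot_closed smult_r_distr)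
  moreover have "lam \<odot>\<^bsub>A\<^esub> l \<ominus>\<^bsub>A\<^esub> lam \<odot>\<^bsub>A\<^esub> r = lam \<odot>\<^bsub>A\<^esub> (l \<ominus>\<^bsub>A\<^esub> r)"
    using lr lam by (simp add: M.minus_eq smult_r_distr smult_r_minus)
  moreover have "aop ?D i (rbop ?D x) (rbop ?D y)
      = (\<zero>\<^bsub>A\<^esub>, lam \<odot>\<^bsub>A\<^esub> (lam \<odot>\<^bsub>A\<^esub> tot A i p q))"
    using pq lam abcd unfolding xy
    by (simp add: p_def[symmetric] q_def[symmetric] tot_smult_left tot_smult_right tot_closed)
  ultimately show "aop ?D i (rbop ?D x) (rbop ?D y) = rbop ?D (aop ?D i x (rbop ?D y)
      \<oplus>\<^bsub>?D\<^esub> aop ?D i (rbop ?D x) y \<oplus>\<^bsub>?D\<^esub> lam \<odot>\<^bsub>?D\<^esub> aop ?D i x y)"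
    by (simp only: double_simps(6) fst_conv snd_conv)
qed

text \<open>The operator sends the image of \<open>a\<close> to \<open>(0, a)\<close>, so in
  \<turnstile> and \<stileturn> only one factor \<open>inv lam\<close> survives. In \<bottom> two of
  them meet the factor \<open>lam\<close> from \<open>dend\<close>, again leaving one.\<close>

lemma embedding_double:
  assumes lam: "lam \<in> carrier K" "lam \<noteq> \<zero>"
  shows "(\<lambda>a. (inv lam \<odot>\<^bsub>A\<^esub> a, \<zero>\<^bsub>A\<^esub>)) \<in> omega_homs K A (dend lam (double lam A))"
    and "inj_on (\<lambda>a. (inv lam \<odot>\<^bsub>A\<^esub> a, \<zero>\<^bsub>A\<^esub>)) (carrier A)"
proof -
  have il: "inv lam \<in> carrier K" "lam \<otimes> inv lam = \<one>"
    using lam field_Units by auto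
  then have il2: "lam \<otimes> (inv lam \<otimes> inv lam) = inv lam"
    using lam by (simp add: R.m_assoc[symmetric])
  have z: "\<ominus>\<^bsub>A\<^esub> \<zero>\<^bsub>A\<^esub> = \<zero>\<^bsub>A\<^esub>"
    using M.r_neg[of "\<zero>\<^bsub>A\<^esub>"] by simp
  have can: "lam \<odot>\<^bsub>A\<^esub> (inv lam \<odot>\<^bsub>A\<^esub> a) = a" if "a \<in> carrier A" for a
    using that lam il by (simp add: smult_assoc1[symmetric])
  show "inj_on (\<lambda>a. (inv lam \<odot>\<^bsub>A\<^esub> a, \<zero>\<^bsub>A\<^esub>)) (carrier A)"
    by (rule inj_onI) (metis can prod.inject)
  show "(\<lambda>a. (inv lam \<odot>\<^bsub>A\<^esub> a, \<zero>\<^bsub>A\<^esub>)) \<in> omega_homs K A (dend lam (double lam A))"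
    using lam il il2
    by (auto simp: omega_homs_def linear_maps_def dend_def smult_r_distr smult_assoc1[symmetric]
        R.m_comm can z aop_closed aop_smult_left aop_smult_right M.minus_eq split: tri.split)
qed

end

section \<open>The algebra of terms modulo the axioms\<close>

primrec term_eval :: "('k, 'm, 'i) rb_alg \<Rightarrow> ('a \<Rightarrow> 'm) \<Rightarrow> ('k, 'i, 'a) rb_term \<Rightarrow> 'm" where
  "term_eval B h (Gen a) = h a"
| "term_eval B h TZero = \<zero>\<^bsub>B\<^esub>"
| "term_eval B h (TAdd s t) = term_eval B h s \<oplus>\<^bsub>B\<^esub> term_eval B h t"
| "term_eval B h (TSmult c t) = c \<odot>\<^bsub>B\<^esub> term_eval B h t"
| "term_eval B h (TOp i s t) = aop B i (term_eval B h s) (term_eval B h t)"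
| "term_eval B h (TRB t) = rbop B (term_eval B h t)"

lemma term_eval_term_subst:
  "term_eval B h (term_subst \<sigma> u) = eval_mono B (\<lambda>k. term_eval B h (\<sigma> k)) u"
  by (induction u) auto

lemma dend_simps [simp]:
  "carrier (dend lam B) = carrier B"
  "zero (dend lam B) = zero B"
  "add (dend lam B) = add B"
  "smult (dend lam B) = smult B"
  "aop (dend lam B) (i, Vdash) x y = aop B i (rbop B x) y"
  "aop (dend lam B) (i, Dashv) x y = aop B i x (rbop B y)"
  "aop (dend lam B) (i, Perp) x y = lam \<odot>\<^bsub>B\<^esub> aop B i x y"
  by (simp_all add: dend_def)

text \<open>Finite support lets \<open>var_identity\<close> list the monomials of an identity;
  coefficients in \<open>K\<close> make the resulting sum a term.\<close>

locale rb_presentation = tri_omega_algebra K A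
  for K :: "('k, 'c) ring_scheme" (structure)
  and A :: "('k, 'a, 'i \<times> tri) omega_alg" (structure) +
  fixes lam :: 'k and S :: "('k, 'i) npoly set"
  assumes lam_closed: "lam \<in> carrier K"
    and S_finpoly: "f \<in> S \<Longrightarrow> finpoly K f"
begin

section \<open>Classes of terms and the operations on them\<close>

abbreviation "T \<equiv> rb_terms K A"
abbreviation "rel \<equiv> rb_rel K lam S A"
abbreviation "U \<equiv> rb_env K lam S A"

definition cls :: "('k, 'i, 'a) rb_term \<Rightarrow> ('k, 'i, 'a) rb_term set" where
  "cls t = rel `` {t}"

lemma term_subst_closed: "range \<sigma> \<subseteq> T \<Longrightarrow> term_subst \<sigma> u \<in> T"
  by (induction u) (auto intro: rb_terms.intros)

lemma foldr_term_closed: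
  assumes "range f \<subseteq> carrier K" "range \<sigma> \<subseteq> T"
  shows "foldr (\<lambda>u. TAdd (TSmult (f u) (term_subst \<sigma> u))) us TZero \<in> T"
  using assms by (induction us) (auto intro!: rb_terms.intros term_subst_closed)

text \<open>This makes \<open>rel\<close> a relation on \<open>T\<close>, as the quotient requires.
  The rules for generators rely on the closure of \<open>A\<close> under its operations,
  \<open>var_identity\<close> on the coefficients lying in \<open>K\<close>.\<close>

lemma rel_closed: "(s, t) \<in> rel \<Longrightarrow> s \<in> T \<and> t \<in> T"
proof (induction rule: rb_rel.induct)
  case (var_identity f \<sigma> us)
  then show ?case
    using S_finpoly by (simp add: finpoly_def foldr_term_closed rb_terms.Zero)
qed (auto intro!: rb_terms.intros aop_closed lam_closed)

lemma equiv_rel: "equiv T rel"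
proof (rule equivI)
  show "rel \<subseteq> T \<times> T"
    using rel_closed by auto
qed (auto simp: refl_on_def sym_def trans_def intro: rb_rel.refl rb_rel.sym rb_rel.trans)

lemma cls_eqI: "(s, t) \<in> rel \<Longrightarrow> cls s = cls t"
  unfolding cls_def by (rule equiv_class_eq[OF equiv_rel])

lemma cls_eq_iff: "s \<in> T \<Longrightarrow> t \<in> T \<Longrightarrow> cls s = cls t \<longleftrightarrow> (s, t) \<in> rel"
  unfolding cls_def by (rule eq_equiv_class_iff[OF equiv_rel])

lemma carrier_U: "carrier U = cls ` T"
  by (auto simp: rb_env_def Let_def quotient_def cls_def)

lemma cls_closed: "t \<in> T \<Longrightarrow> cls t \<in> carrier U"
  by (simp add: carrier_U)

lemma zero_U: "\<zero>\<^bsub>U\<^esub> = cls TZero"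
  by (simp add: rb_env_def Let_def cls_def)

lemma UN_cls2:
  assumes "s \<in> T" "t \<in> T"
    and "\<And>s s' t t'. (s, s') \<in> rel \<Longrightarrow> (t, t') \<in> rel \<Longrightarrow> (F s t, F s' t') \<in> rel"
  shows "(\<Union>s\<in>cls s. \<Union>t\<in>cls t. cls (F s t)) = cls (F s t)"
  unfolding cls_def[of s] cls_def[of t]
  by (rule UN_equiv_class2[OF equiv_rel equiv_rel _ assms(1,2)])
    (auto simp: congruent2_def intro!: cls_eqI assms(3))

lemma UN_cls:
  assumes "t \<in> T" "\<And>t t'. (t, t') \<in> rel \<Longrightarrow> (F t, F t') \<in> rel"
  shows "(\<Union>t\<in>cls t. cls (F t)) = cls (F t)"
  unfolding cls_def[of t]
  by (rule UN_equiv_class[OF equiv_rel _ assms(1)])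
    (auto simp: congruent_def intro!: cls_eqI assms(2))

lemma add_U: "s \<in> T \<Longrightarrow> t \<in> T \<Longrightarrow> cls s \<oplus>\<^bsub>U\<^esub> cls t = cls (TAdd s t)"
  using UN_cls2[of s t TAdd] by (simp add: rb_env_def Let_def cls_def rb_rel.cong_add)

lemma smult_U: "c \<in> carrier K \<Longrightarrow> t \<in> T \<Longrightarrow> c \<odot>\<^bsub>U\<^esub> cls t = cls (TSmult c t)"
  using UN_cls[of t "TSmult c"] by (simp add: rb_env_def Let_def cls_def rb_rel.cong_smult)

lemma aop_U: "s \<in> T \<Longrightarrow> t \<in> T \<Longrightarrow> aop U i (cls s) (cls t) = cls (TOp i s t)"
  using UN_cls2[of s t "TOp i"] by (simp add: rb_env_def Let_def cls_def rb_rel.cong_op)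

lemma rbop_U: "t \<in> T \<Longrightarrow> rbop U (cls t) = cls (TRB t)"
  using UN_cls[of t TRB] by (simp add: rb_env_def Let_def cls_def rb_rel.cong_rb)

lemmas U_simps = zero_U add_U smult_U aop_U rbop_U lam_closed rb_terms.intros

section \<open>The quotient as a Rota--Baxter algebra of the variety\<close>

lemma omega_algebra_U: "omega_algebra K U"
proof -
  have ag: "abelian_group U"
  proof (rule abelian_groupI)
    fix X assume "X \<in> carrier U"
    then obtain s where s: "s \<in> T" "X = cls s"
      by (auto simp: carrier_U)
    \<comment> \<open>Terms have no symbol for negation; by \<open>add_neg\<close> the multiple by
      minus one is the additive inverse.\<close>
    have "cls (TSmult (\<ominus> \<one>) s) \<oplus>\<^bsub>U\<^esub> X = \<zero>\<^bsub>U\<^esub>"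
      using s by (simp add: U_simps cls_eq_iff rb_rel.add_neg del: subset_antisym)
    then show "\<exists>Y\<in>carrier U. Y \<oplus>\<^bsub>U\<^esub> X = \<zero>\<^bsub>U\<^esub>"
      using s by (auto intro!: bexI[of _ "cls (TSmult (\<ominus> \<one>) s)"] cls_closed rb_terms.intros)
  qed (auto simp: carrier_U U_simps cls_eq_iff rb_rel.add_assoc rb_rel.add_comm rb_rel.add_zero
      del: subset_antisym)
  interpret U: module K U
    by (rule moduleI[OF R.is_cring ag])
      (auto simp: carrier_U U_simps cls_eq_iff rb_rel.smult_add_left rb_rel.smult_add_right
        rb_rel.smult_assoc rb_rel.smult_one del: subset_antisym)
  show ?thesis
    by unfold_locales
      (auto simp: carrier_U U_simps cls_eq_iff rb_rel.op_add_left rb_rel.op_add_right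
        rb_rel.op_smult_left rb_rel.op_smult_right del: subset_antisym)
qed

lemma eval_mono_U:
  "range \<sigma> \<subseteq> T \<Longrightarrow> eval_mono U (\<lambda>k. cls (\<sigma> k)) u = cls (term_subst \<sigma> u)"
  by (induction u) (auto simp: aop_U term_subst_closed)

lemma satisfies_U:
  assumes "f \<in> S"
  shows "satisfies K U f"
  unfolding satisfies_def
proof (intro allI impI)
  interpret U: omega_algebra K U
    by (rule omega_algebra_U)
  fix \<tau> :: "nat \<Rightarrow> ('k, 'i, 'a) rb_term set"
  assume "range \<tau> \<subseteq> carrier U"
  \<comment> \<open>Representatives turn an assignment of classes into a substitution of terms, the
    form in which \<open>var_identity\<close> applies.\<close>
  then have "\<forall>k. \<exists>t. t \<in> T \<and> \<tau> k = cls t"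
    by (auto simp: carrier_U)
  then obtain \<sigma> where \<sigma>: "\<And>k. \<sigma> k \<in> T" "\<tau> = (\<lambda>k. cls (\<sigma> k))"
    by metis
  then have r: "range \<sigma> \<subseteq> T"
    by auto
  have f: "finpoly K f"
    using assms by (rule S_finpoly)
  have fc: "f u \<in> carrier K" for u
    using f by (rule finpoly_closed)
  have fr: "range f \<subseteq> carrier K"
    using f by (simp add: finpoly_def)
  have "finite (supp K f)"
    using f by (simp add: finpoly_def)
  \<comment> \<open>A term for a sum fixes an order of the summands. As \<open>var_identity\<close>
    covers every enumeration of the support, any choice of \<open>us\<close> will do.\<close>
  then obtain us where us: "set us = supp K f" "distinct us"
    using finite_distinct_list[of "supp K f"] by metis
  have "(\<Oplus>\<^bsub>U\<^esub>u\<in>set us. f u \<odot>\<^bsub>U\<^esub> eval_mono U \<tau> u)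
      = cls (foldr (\<lambda>u. TAdd (TSmult (f u) (term_subst \<sigma> u))) us TZero)"
    using us(2)
  proof (induction us)
    case Nil
    show ?case
      by (simp add: zero_U)
  next
    case (Cons u us)
    have "f u \<odot>\<^bsub>U\<^esub> eval_mono U \<tau> u \<in> carrier U" for u
      using fc r by (auto simp: \<sigma>(2) eval_mono_U term_subst_closed U_simps intro!: cls_closed)
    then have "(\<Oplus>\<^bsub>U\<^esub>u\<in>set (u # us). f u \<odot>\<^bsub>U\<^esub> eval_mono U \<tau> u)
        = f u \<odot>\<^bsub>U\<^esub> eval_mono U \<tau> u \<oplus>\<^bsub>U\<^esub> (\<Oplus>\<^bsub>U\<^esub>u\<in>set us. f u \<odot>\<^bsub>U\<^esub> eval_mono U \<tau> u)"
      using Cons.prems by (simp add: Pi_def)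
    then show ?case
      using Cons r fc
      by (simp add: \<sigma>(2) eval_mono_U U_simps term_subst_closed foldr_term_closed[OF fr])
  qed
  also have "\<dots> = \<zero>\<^bsub>U\<^esub>"
    using rb_rel.var_identity[OF assms r us(2,1)] by (simp add: zero_U cls_eqI)
  finally show "eval_poly K U \<tau> f = \<zero>\<^bsub>U\<^esub>"
    by (simp add: eval_poly_def us)
qed

lemma rb_var_algebra_U: "rb_var_algebra K lam S U"
  unfolding rb_var_algebra_def var_algebra_def linear_maps_def
  by (auto simp: omega_algebra_U satisfies_U carrier_U U_simps cls_eq_iff
      rb_rel.rb_add rb_rel.rb_smult rb_rel.rota_baxter
      del: subset_antisym)

lemma rb_env_map_hom: "rb_env_map K lam S A \<in> omega_homs K A (dend lam U)"
proof -
  have "cls (Gen (aop A (i, t) x y)) = aop (dend lam U) (i, t) (cls (Gen x)) (cls (Gen y))"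
    if "x \<in> carrier A" "y \<in> carrier A" for i t x y
    using that by (cases t)
      (simp_all add: U_simps aop_closed cls_eq_iff rb_rel.gen_vdash rb_rel.gen_dashv rb_rel.gen_perp)
  then show ?thesis
    by (auto simp: omega_homs_def linear_maps_def rb_env_map_def cls_def[symmetric] U_simps
        aop_closed cls_closed cls_eq_iff rb_rel.gen_add rb_rel.gen_smult del: subset_antisym)
qed

section \<open>The universal property\<close>

context
  fixes B :: "('k, 'b, 'i) rb_alg" and h :: "'a \<Rightarrow> 'b"
  assumes B: "rb_var_algebra K lam S B" and h: "h \<in> omega_homs K A (dend lam B)"
begin

interpretation B: omega_algebra K B
  using B by (simp add: rb_var_algebra_def var_algebra_def)

lemma rbop_linear: "rbop B \<in> linear_maps K B B"
  using B by (simp add: rb_var_algebra_def)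

lemma term_eval_closed: "t \<in> T \<Longrightarrow> term_eval B h t \<in> carrier B"
proof (induction rule: rb_terms.induct)
  case (Gen a)
  then show ?case
    using h by (auto simp: omega_homs_def linear_maps_def)
qed (auto intro: B.aop_closed linear_mapsD(1)[OF rbop_linear])

lemma term_eval_foldr:
  assumes "range f \<subseteq> carrier K" "range \<sigma> \<subseteq> T" "distinct us"
  shows "term_eval B h (foldr (\<lambda>u. TAdd (TSmult (f u) (term_subst \<sigma> u))) us TZero)
    = (\<Oplus>\<^bsub>B\<^esub>u\<in>set us. f u \<odot>\<^bsub>B\<^esub> eval_mono B (\<lambda>k. term_eval B h (\<sigma> k)) u)"
  using assms(3)
proof (induction us)
  case (Cons u us)
  have "f u \<odot>\<^bsub>B\<^esub> eval_mono B (\<lambda>k. term_eval B h (\<sigma> k)) u \<in> carrier B" for u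
    using assms term_eval_closed
    by (intro B.smult_closed B.eval_mono_closed) auto
  then show ?case
    using Cons by (simp add: Pi_def term_eval_term_subst)
qed simp

text \<open>Each rule of \<open>rb_rel\<close> is an equation valid in \<open>B\<close>: an axiom of
  Rota--Baxter algebras, an identity from \<open>S\<close>, or the homomorphism property of
  \<open>h\<close> on generators. Hence evaluation descends to classes.\<close>

lemma term_eval_rel: "(s, t) \<in> rel \<Longrightarrow> term_eval B h s = term_eval B h t"
proof (induction rule: rb_rel.induct)
  case (var_identity f \<sigma> us)
  then have "range f \<subseteq> carrier K"
    using S_finpoly by (auto simp: finpoly_def)
  moreover have "satisfies K B f"
    using B var_identity(1) by (simp add: rb_var_algebra_def var_algebra_def)
  moreover have "range (\<lambda>k. term_eval B h (\<sigma> k)) \<subseteq> carrier B"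
    using var_identity(2) term_eval_closed by auto
  ultimately show ?case
    using var_identity by (simp add: term_eval_foldr satisfies_def eval_poly_def)
next
  case (add_neg s)
  then have s: "term_eval B h s \<in> carrier B"
    by (rule term_eval_closed)
  then have "\<ominus> \<one> \<odot>\<^bsub>B\<^esub> term_eval B h s = \<ominus>\<^bsub>B\<^esub> term_eval B h s"
    by (simp add: B.smult_l_minus)
  then show ?case
    using s by (simp add: B.M.l_neg)
next
  case (rota_baxter s t i)
  then show ?case
    using B term_eval_closed by (auto simp: rb_var_algebra_def B.M.add.m_comm)
next
  case (gen_vdash a b i)
  then show ?case
    using h by (simp add: omega_homs_def)
next
  case (gen_dashv a b i)
  then show ?case
    using h by (simp add: omega_homs_def)
next
  case (gen_perp a b i)
  then show ?case
    using h by (simp add: omega_homs_def)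
next
  case (gen_add a b)
  then show ?case
    using h by (simp add: omega_homs_def linear_maps_def)
next
  case (gen_smult c a)
  then show ?case
    using h by (simp add: omega_homs_def linear_maps_def)
qed (simp_all add: term_eval_closed linear_mapsD[OF rbop_linear]
    B.M.add.m_assoc B.M.add.m_comm B.M.add.m_lcomm B.smult_l_distr B.smult_r_distr B.smult_assoc1 B.aop_add_left B.aop_add_right
    B.aop_smult_left B.aop_smult_right)

text \<open>On a class of terms the choice of the representative is immaterial by
  \<open>term_eval_rel\<close>.\<close>

definition env_hom :: "('k, 'i, 'a) rb_term set \<Rightarrow> 'b" where
  "env_hom X = term_eval B h (SOME t. t \<in> X)"

lemma env_hom_cls: "t \<in> T \<Longrightarrow> env_hom (cls t) = term_eval B h t"
  unfolding env_hom_def cls_def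
  by (rule someI2[of _ t]) (auto simp: rb_rel.refl intro: term_eval_rel[symmetric])

lemma env_hom_rb_hom: "env_hom \<in> rb_homs K U B"
  unfolding rb_homs_def omega_homs_def linear_maps_def
  by (auto simp: carrier_U U_simps env_hom_cls term_eval_closed)

text \<open>Every class is obtained from classes of generators by operations that
  \<open>\<psi>\<close> preserves, so induction on terms determines \<open>\<psi>\<close>.\<close>

lemma env_hom_unique:
  assumes \<psi>: "\<psi> \<in> rb_homs K U B" and gen: "\<forall>a\<in>carrier A. \<psi> (rb_env_map K lam S A a) = h a"
    and X: "X \<in> carrier U"
  shows "\<psi> X = env_hom X"
proof -
  have lin: "\<psi> \<in> linear_maps K U B"
    using \<psi> by (simp add: rb_homs_def omega_homs_def)
  have "\<psi> (cls t) = term_eval B h t" if "t \<in> T" for t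
    using that
  proof (induction rule: rb_terms.induct)
    case (Gen a)
    then show ?case
      using gen by (simp add: rb_env_map_def cls_def)
  next
    case Zero
    \<comment> \<open>Preservation of zero is not among the clauses of \<open>linear_maps\<close>;
      it follows from scalar multiplication by zero.\<close>
    have z: "cls TZero \<in> carrier U"
      by (intro cls_closed rb_terms.Zero)
    have "cls TZero = \<zero> \<odot>\<^bsub>U\<^esub> cls TZero"
      using omega_algebra.axioms(1)[OF omega_algebra_U] module.smult_l_null[of K U "cls TZero"] z
      by (simp add: zero_U)
    then have "\<psi> (cls TZero) = \<zero> \<odot>\<^bsub>B\<^esub> \<psi> (cls TZero)"
      using linear_mapsD(3)[OF lin R.zero_closed z] by simp
    then show ?case
      using linear_mapsD(1)[OF lin z] by simp
  next
    case (Add s t)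
    then show ?case
      using linear_mapsD(2)[OF lin, of "cls s" "cls t"] by (simp add: cls_closed add_U)
  next
    case (Smult c t)
    then show ?case
      using linear_mapsD(3)[OF lin, of c "cls t"] by (simp add: cls_closed smult_U)
  next
    case (Op s t i)
    then have "\<psi> (aop U i (cls s) (cls t)) = aop B i (\<psi> (cls s)) (\<psi> (cls t))"
      using \<psi> cls_closed by (auto simp: rb_homs_def omega_homs_def)
    then show ?case
      using Op by (simp add: aop_U)
  next
    case (RB t)
    then have "\<psi> (rbop U (cls t)) = rbop B (\<psi> (cls t))"
      using \<psi> cls_closed by (auto simp: rb_homs_def)
    then show ?case
      using RB by (simp add: rbop_U)
  qed
  then show ?thesis
    using X by (auto simp: carrier_U env_hom_cls)
qed

end

text \<open>The envelope is the same for every \<open>'b\<close>, so this can be instantiated with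
  the element type of any test algebra.\<close>

lemma universal_rb_env:
  "universal_rb_envelope TYPE('b) K lam S A U (rb_env_map K lam S A)"
  unfolding universal_rb_envelope_def
proof (intro conjI allI impI rb_var_algebra_U rb_env_map_hom)
  fix B :: "('k, 'b, 'i) rb_alg" and h
  assume "rb_var_algebra K lam S B \<and> h \<in> omega_homs K A (dend lam B)"
  then have B: "rb_var_algebra K lam S B" and h: "h \<in> omega_homs K A (dend lam B)"
    by auto
  show "\<exists>\<phi>\<in>rb_homs K U B. (\<forall>a\<in>carrier A. \<phi> (rb_env_map K lam S A a) = h a) \<and>
      (\<forall>\<psi>\<in>rb_homs K U B. (\<forall>a\<in>carrier A. \<psi> (rb_env_map K lam S A a) = h a) \<longrightarrow>
        (\<forall>x\<in>carrier U. \<psi> x = \<phi> x))"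
    using env_hom_rb_hom[OF B h] env_hom_cls[OF B h] env_hom_unique[OF B h]
    by (intro bexI[of _ "env_hom B h"]) (auto simp: rb_env_map_def cls_def[symmetric] rb_terms.Gen)
qed

end

theorem corollary2:
  fixes K :: "('k, 'c) ring_scheme" and lam :: 'k
    and S :: "('k, 'i) npoly set"
    and A :: "('k, 'a, 'i \<times> tri) omega_alg"
  assumes "field K"
    and "lam \<in> carrier K" and "lam \<noteq> \<zero>\<^bsub>K\<^esub>"
    and "\<forall>f\<in>S. \<exists>n>1. polylinear K n f"
    and "tri_dendriform K S A"
  shows "universal_rb_envelope TYPE('b) K lam S A (rb_env K lam S A) (rb_env_map K lam S A)
    \<and> inj_on (rb_env_map K lam S A) (carrier A)"
proof
  interpret A: omega_algebra K A
    using assms(5) by (simp add: tri_dendriform_def)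
  interpret rb_presentation K A lam S
    by unfold_locales (use assms(2,4) in \<open>auto intro: polylinear_imp_finpoly\<close>)
  show "universal_rb_envelope TYPE('b) K lam S A (rb_env K lam S A) (rb_env_map K lam S A)"
    by (rule universal_rb_env)
  let ?h = "\<lambda>a. (inv\<^bsub>K\<^esub> lam \<odot>\<^bsub>A\<^esub> a, \<zero>\<^bsub>A\<^esub>)"
  have "rb_var_algebra K lam S (double lam A)"
    using assms by (intro rb_var_algebra_double) auto
  \<comment> \<open>The test algebra is the double, so the universal property is taken at
    \<open>'a \<times> 'a\<close>, whatever \<open>'b\<close> is. Elements with the same canonical
    image then have the same image under the injective map \<open>?h\<close>.\<close>
  then obtain \<phi> where "\<forall>a\<in>carrier A. \<phi> (rb_env_map K lam S A a) = ?h a"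
    using universal_rb_env[where ?'b = "'a \<times> 'a"] embedding_double(1)[OF assms(2,3)]
    unfolding universal_rb_envelope_def by blast
  then show "inj_on (rb_env_map K lam S A) (carrier A)"
    using embedding_double(2)[OF assms(2,3)] by (metis (no_types, lifting) inj_on_def)
qed

end
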